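(* On formal power series in $x$ consider the binary operations $$\gamma_{\sqcup}(f,g)=\text{the Hadamard (coefficientwise) product of } f \text{ and } g,\qquad \gamma_{\oplus}(f,g)=f\,(1-x)\,g .$$ Then the $\mathcal{SP}$-algebra generated by $\mathcal{SH}(1)=\frac{1}{(1-x)^2}$ under these operations is the $\mathcal{SP}$-algebra of shuffle series. That is, for every series-parallel poset $P$ with $|P|=n$ and every factorization of $P$, replacing each of the $n$ leaves of the factorization by $\frac{1}{(1-x)^2}$ and evaluating each vertex labeled $\sqcup$ by $\gamma_\sqcup$ and each vertex labeled $\oplus$ by $\gamma_\oplus$ yields at the root exactly the shuffle series $\mathcal{SH}(P)$.
   Context: Posets are finite and considered up to isomorphism. $\langle n\rangle$ is the chain $1<2<\cdots<n$ ($\langle 0\rangle$ is empty). $P\sqcup Q$ is the disjoint union of posets (no new relations); $P\oplus Q$ is the ordinal sum (every element of $P$ is put below every element of $Q$). A series-parallel poset ($SP$-poset) is a poset obtained from one-point posets by finitely many applications of $\sqcup$ and $\oplus$. A factorization of an $SP$-poset $P$ with $n$ points is a planar rooted binary tree with $n$ leaves whose vertices are labeled by $\sqcup$ or $\oplus$, such that evaluating it with a one-point poset at each leaf gives $P$. Shuffles. Let $P$ be an $SP$-poset. A (colimit-indexing) shuffle of $P$ and $\langle n\rangle$ is a finite poset $A$ such that: every point of $A$ is labeled by a point of $P$ or a point of $\langle n\rangle$; $A$ has the same number of minimal points as $P$; $A$ has the same number of maximal points as $P$; and there is a bijection $M\mapsto A_M$ from maximal chains of $P$ to maximal chains of $A$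 such that $A_M$ is a shuffle of $M$ and $\langle n\rangle$, i.e. the labels along $A_M$ list every element of $M$ and every element of $\langle n\rangle$ exactly once, preserving the order of $M$ and the order of $\langle n\rangle$. Every point of $P$ labels exactly one point of $A$ (a point of $\langle n\rangle$ may label several points of $A$), and two shuffles are identified if for every maximal chain $M$ of $P$ the label sequences along the corresponding chains coincide. $\hom_{Shuffle}(P,\langle n\rangle)$ is the set of such shuffles; for $n=0$ the only shuffle is $P$ itself. The shuffle series is $\mathcal{SH}(P)=\sum_{n=0}^\infty \#\hom_{Shuffle}(P,\langle n\rangle)x^n$, and $\mathcal{SH}(k):=\mathcal{SH}(\langle k\rangle)$. *)

theory Defs
  imports
    "HOL-Computational_Algebra.Formal_Power_Series"
    "HOL-Library.Tree"
begin

section \<open>Posets\<close>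

text \<open>
  A poset is given by its (reflexive) order relation \<open>r\<close>; its points are \<open>Field r\<close>, and
  being a poset is \<open>Partial_order r\<close>. Posets are considered up to isomorphism, so the disjoint
  union and the ordinal sum are formed from copies with disjoint sets of points; these
  disjointness conditions appear in the inductive definitions below.
\<close>

definition poset_union :: "'a rel \<Rightarrow> 'a rel \<Rightarrow> 'a rel" where
  "poset_union P Q = P \<union> Q"

definition ordinal_sum :: "'a rel \<Rightarrow> 'a rel \<Rightarrow> 'a rel" where
  "ordinal_sum P Q = P \<union> Q \<union> Field P \<times> Field Q"

inductive sp_poset :: "'a rel \<Rightarrow> bool" where
  sp_point: "sp_poset {(a, a)}"
| sp_union: "sp_poset P \<Longrightarrow> sp_poset Q \<Longrightarrow> Field P \<inter> Field Q = {} \<Longrightarrow> sp_poset (poset_union P Q)"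
| sp_osum: "sp_poset P \<Longrightarrow> sp_poset Q \<Longrightarrow> Field P \<inter> Field Q = {} \<Longrightarrow> sp_poset (ordinal_sum P Q)"

definition chain_poset :: "nat \<Rightarrow> nat rel" where
  "chain_poset n = {(i, j). 1 \<le> i \<and> i \<le> j \<and> j \<le> n}"

definition minimal_points :: "'a rel \<Rightarrow> 'a set" where
  "minimal_points r = {x \<in> Field r. \<forall>y. (y, x) \<in> r \<longrightarrow> y = x}"

definition maximal_points :: "'a rel \<Rightarrow> 'a set" where
  "maximal_points r = {x \<in> Field r. \<forall>y. (x, y) \<in> r \<longrightarrow> y = x}"

text \<open>
  A maximal chain of a finite poset is represented by the list of its points in increasing order.
\<close>

definition max_chains :: "'a rel \<Rightarrow> 'a list set" where
  "max_chains r = {xs. distinct xs \<and> sorted_wrt (\<lambda>x y. (x, y) \<in> r) xs \<and>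
     set xs \<in> Chains r \<and> (\<forall>C \<in> Chains r. set xs \<subseteq> C \<longrightarrow> C = set xs)}"


section \<open>Factorizations\<close>

datatype sp_op = Union_op | Osum_op

text \<open>
  A planar rooted binary tree with vertices labeled by the two operations is an \<open>sp_op tree\<close>;
  its number of leaves is \<open>size1\<close>. The relation \<open>tree_evaluates_to t P\<close> says that \<open>P\<close> is, up to
  isomorphism, the value of \<open>t\<close> with a one-point poset at each leaf.
\<close>

inductive tree_evaluates_to :: "sp_op tree \<Rightarrow> 'a rel \<Rightarrow> bool" where
  eval_leaf: "tree_evaluates_to Leaf {(a, a)}"
| eval_union: "tree_evaluates_to s P \<Longrightarrow> tree_evaluates_to t Q \<Longrightarrow> Field P \<inter> Field Q = {} \<Longrightarrow>
    tree_evaluates_to (Node s Union_op t) (poset_union P Q)"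
| eval_osum: "tree_evaluates_to s P \<Longrightarrow> tree_evaluates_to t Q \<Longrightarrow> Field P \<inter> Field Q = {} \<Longrightarrow>
    tree_evaluates_to (Node s Osum_op t) (ordinal_sum P Q)"

definition factorization :: "sp_op tree \<Rightarrow> 'a rel \<Rightarrow> bool" where
  "factorization t P \<longleftrightarrow> size1 t = card (Field P) \<and> tree_evaluates_to t P"


section \<open>Shuffles of a poset and a chain\<close>

text \<open>
  A point of a shuffle is labeled by \<open>Inl p\<close> for a point \<open>p\<close> of \<open>P\<close>, or by \<open>Inr i\<close> for a point \<open>i\<close>
  of the chain on \<open>{1..n}\<close>. Since shuffles are finite, it is no restriction to take natural
  numbers as their points. In \<open>is_shuffle_via P n A lab \<beta>\<close>, \<open>\<beta>\<close> is the bijection from the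
  maximal chains of \<open>P\<close> to those of \<open>A\<close>.
\<close>

definition is_shuffle_via ::
  "'a rel \<Rightarrow> nat \<Rightarrow> nat rel \<Rightarrow> (nat \<Rightarrow> 'a + nat) \<Rightarrow> ('a list \<Rightarrow> nat list) \<Rightarrow> bool" where
  "is_shuffle_via P n A lab \<beta> \<longleftrightarrow>
     Partial_order A \<and> finite (Field A) \<and>
     lab ` Field A \<subseteq> Inl ` Field P \<union> Inr ` {1..n} \<and>
     (\<forall>p \<in> Field P. \<exists>!a. a \<in> Field A \<and> lab a = Inl p) \<and>
     card (minimal_points A) = card (minimal_points P) \<and>
     card (maximal_points A) = card (maximal_points P) \<and>
     bij_betw \<beta> (max_chains P) (max_chains A) \<and>
     (\<forall>M \<in> max_chains P. map lab (\<beta> M) \<in> shuffles (map Inl M) (map Inr [1..<Suc n]))"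

definition poset_shuffles :: "'a rel \<Rightarrow> nat \<Rightarrow> (nat rel \<times> (nat \<Rightarrow> 'a + nat)) set" where
  "poset_shuffles P n = {(A, lab). \<exists>\<beta>. is_shuffle_via P n A lab \<beta>}"

definition shuffle_equiv ::
  "'a rel \<Rightarrow> nat \<Rightarrow> (nat rel \<times> (nat \<Rightarrow> 'a + nat)) rel" where
  "shuffle_equiv P n = {((A, lab), (A', lab')).
     \<exists>\<beta> \<beta>'. is_shuffle_via P n A lab \<beta> \<and> is_shuffle_via P n A' lab' \<beta>' \<and>
       (\<forall>M \<in> max_chains P. map lab (\<beta> M) = map lab' (\<beta>' M))}"

definition hom_shuffle :: "'a rel \<Rightarrow> nat \<Rightarrow> (nat rel \<times> (nat \<Rightarrow> 'a + nat)) set set" where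
  "hom_shuffle P n = poset_shuffles P n // shuffle_equiv P n"

definition shuffle_series :: "'a rel \<Rightarrow> rat fps" where
  "shuffle_series P = Abs_fps (\<lambda>n. of_nat (card (hom_shuffle P n)))"


section \<open>The operations on power series\<close>

definition gamma_union :: "rat fps \<Rightarrow> rat fps \<Rightarrow> rat fps" where
  "gamma_union f g = Abs_fps (\<lambda>n. fps_nth f n * fps_nth g n)"

definition gamma_osum :: "rat fps \<Rightarrow> rat fps \<Rightarrow> rat fps" where
  "gamma_osum f g = f * (1 - fps_X) * g"

fun tree_series :: "rat fps \<Rightarrow> sp_op tree \<Rightarrow> rat fps" where
  "tree_series f Leaf = f"
| "tree_series f (Node s Union_op t) = gamma_union (tree_series f s) (tree_series f t)"
| "tree_series f (Node s Osum_op t) = gamma_osum (tree_series f s) (tree_series f t)"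

text \<open>The underlying set of the algebra generated by \<open>f\<close> under the two operations.\<close>

inductive_set sp_generated :: "rat fps \<Rightarrow> rat fps set" for f :: "rat fps" where
  gen_base: "f \<in> sp_generated f"
| gen_union: "g \<in> sp_generated f \<Longrightarrow> h \<in> sp_generated f \<Longrightarrow> gamma_union g h \<in> sp_generated f"
| gen_osum: "g \<in> sp_generated f \<Longrightarrow> h \<in> sp_generated f \<Longrightarrow> gamma_osum g h \<in> sp_generated f"

end

theory Submission
  imports Defs
begin

text \<open>
  A shuffle of \<open>P\<close> and \<open>\<langle>n\<rangle>\<close> is the same as an isotone map \<open>h\<close> from \<open>P\<close> to \<open>{0..n}\<close>: \<open>h p\<close> is the number
  of points of \<open>\<langle>n\<rangle>\<close> below \<open>p\<close>. This number does not depend on the maximal chain along which one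
  counts, because two maximal chains of a shuffle meeting in a point \<open>a\<close> can be crossed over at \<open>a\<close>,
  and the crossed chain has to contain all \<open>n\<close> labels as well. Conversely, \<open>h\<close> is realized by
  induction on the series-parallel structure; for an ordinal sum the chain is cut at the largest
  value \<open>m\<close> of \<open>h\<close> on the lower part. Hence the coefficients count isotone maps: they multiply under
  disjoint unions, and for an ordinal sum one sums over \<open>m\<close>, where \<open>f (1 - x)\<close> counts the isotone
  maps on the lower part with largest value exactly \<open>m\<close>.
\<close>

section \<open>Maximal chains and extremal points\<close>

text \<open>\<open>shuffle_equiv\<close> quantifies its two bijections existentially, so a witness
  obtained from it is not known to be the bijection fixed beforehand. Heights are therefore compared
  across two bijections at once; this makes the classes exactly the sets of labelled posets with a
  given height map. The realization of \<open>h\<close> cannot be proved by induction for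
  \<open>{1..n}\<close> alone, because the summands of an ordinal sum receive consecutive segments.
  The induction runs over segments with letters in \<open>{Suc l..u}\<close> and heights in
  \<open>{l..u}\<close>. It also carries a free lower bound \<open>N\<close> on the points:
  realizations of two summands must have disjoint fields, so the second is built beyond the first.
  An ordinal sum could be cut at any value between the largest lower and the smallest upper value of
  \<open>h\<close>. Taking the largest lower value makes the cut a function of \<open>h\<close>, so
  each map is counted once. Maps attaining \<open>m\<close> are those bounded by \<open>m\<close>
  minus those bounded by \<open>m - 1\<close>; this difference is the origin of the factor 1 -
  x.\<close>

lemma Field_poset_union [simp]: "Field (poset_union P Q) = Field P \<union> Field Q"
  by (auto simp: poset_union_def Field_def)

lemma Field_ordinal_sum [simp]: "Field (ordinal_sum P Q) = Field P \<union> Field Q"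
  by (auto simp: ordinal_sum_def Field_def)

lemma in_poset_union: "(x, y) \<in> poset_union P Q \<longleftrightarrow> (x, y) \<in> P \<or> (x, y) \<in> Q"
  by (simp add: poset_union_def)

lemma in_ordinal_sum:
  "(x, y) \<in> ordinal_sum P Q \<longleftrightarrow> (x, y) \<in> P \<or> (x, y) \<in> Q \<or> x \<in> Field P \<and> y \<in> Field Q"
  by (auto simp: ordinal_sum_def)

lemma partial_order_poset_union:
  assumes "Partial_order P" "Partial_order Q" "Field P \<inter> Field Q = {}"
  shows "Partial_order (poset_union P Q)"
proof -
  have "Field (P \<union> Q) = Field P \<union> Field Q"
    by (auto simp: Field_def)
  moreover have "trans (P \<union> Q)"
    using assms unfolding partial_order_on_def preorder_on_def trans_def Field_def by blast
  moreover have "antisym (P \<union> Q)"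
    using assms unfolding partial_order_on_def antisym_def Field_def by blast
  ultimately show ?thesis
    using assms by (auto simp: poset_union_def partial_order_on_def preorder_on_def refl_on_def Field_def)
qed

lemma partial_order_ordinal_sum:
  assumes "Partial_order P" "Partial_order Q" "Field P \<inter> Field Q = {}"
  shows "Partial_order (ordinal_sum P Q)"
proof -
  have P: "trans P" "antisym P" "Refl P" and Q: "trans Q" "antisym Q" "Refl Q"
    using assms by (auto simp: partial_order_on_def preorder_on_def)
  have fP: "(x, y) \<in> P \<Longrightarrow> x \<in> Field P \<and> y \<in> Field P" for x y
    by (auto simp: Field_def)
  have fQ: "(x, y) \<in> Q \<Longrightarrow> x \<in> Field Q \<and> y \<in> Field Q" for x y
    by (auto simp: Field_def)
  have "trans (ordinal_sum P Q)"
    unfolding trans_def ordinal_sum_def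
    using P(1) Q(1) fP fQ assms(3) by (blast dest: transD)
  moreover have "antisym (ordinal_sum P Q)"
    unfolding antisym_def ordinal_sum_def
    using P(2) Q(2) fP fQ assms(3) by (blast dest: antisymD)
  moreover have "Refl (ordinal_sum P Q)"
    unfolding Field_ordinal_sum using P(3) Q(3) by (auto simp: refl_on_def ordinal_sum_def)
  moreover have "ordinal_sum P Q \<subseteq> Field (ordinal_sum P Q) \<times> Field (ordinal_sum P Q)"
    by (auto simp: Field_def)
  ultimately show ?thesis
    unfolding partial_order_on_def preorder_on_def by blast
qed

lemma sp_poset_partial_order:
  assumes "sp_poset P"
  shows "Partial_order P" "finite (Field P)" "Field P \<noteq> {}"
proof -
  have "Partial_order P \<and> finite (Field P) \<and> Field P \<noteq> {}"
    using assms
  proof induction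
    case (sp_point a)
    then show ?case
      by (auto simp: partial_order_on_def preorder_on_def refl_on_def trans_def antisym_def)
  \<comment> \<open>\<open>Partial_order\<close> hides a \<open>Field\<close> that the simp rules
    for sums would rewrite first; they are switched off until the order property is
    discharged.\<close>
  qed (simp_all add: partial_order_poset_union partial_order_ordinal_sum
      del: Field_poset_union Field_ordinal_sum, simp_all)
  then show "Partial_order P" "finite (Field P)" "Field P \<noteq> {}"
    by auto
qed

text \<open>A chain that can be enlarged at all can be enlarged by a single point, so maximality
  reduces to comparing single points with the list. Reflexivity makes the enlarged set a
  chain.\<close>

lemma max_chains_iff:
  assumes "Refl r"
  shows "xs \<in> max_chains r \<longleftrightarrow> distinct xs \<and> sorted_wrt (\<lambda>x y. (x, y) \<in> r) xs \<and>
    set xs \<subseteq> Field r \<and>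
    (\<forall>x\<in>Field r. (\<forall>y\<in>set xs. (x, y) \<in> r \<or> (y, x) \<in> r) \<longrightarrow> x \<in> set xs)" (is "_ \<longleftrightarrow> ?R")
proof
  assume xs: "xs \<in> max_chains r"
  then have chain: "\<And>a b. a \<in> set xs \<Longrightarrow> b \<in> set xs \<Longrightarrow> (a, b) \<in> r \<or> (b, a) \<in> r"
    by (auto simp: max_chains_def Chains_def)
  have "x \<in> set xs" if "x \<in> Field r" "\<forall>y\<in>set xs. (x, y) \<in> r \<or> (y, x) \<in> r" for x
  proof -
    have "insert x (set xs) \<in> Chains r"
      using that chain assms by (auto simp: Chains_def refl_on_def)
    then show ?thesis
      using xs unfolding max_chains_def by blast
  qed
  moreover have "set xs \<subseteq> Field r"
    using chain FieldI1 by fast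
  ultimately show ?R
    using xs by (simp add: max_chains_def)
next
  assume R: ?R
  have chain: "(a, b) \<in> r \<or> (b, a) \<in> r" if ab: "a \<in> set xs" "b \<in> set xs" for a b
  proof (cases "a = b")
    case True
    then show ?thesis using R ab assms by (auto simp: refl_on_def)
  next
    case False
    obtain i j where ij: "i < length xs" "j < length xs" "a = xs ! i" "b = xs ! j"
      using ab by (metis in_set_conv_nth)
    then show ?thesis
      using R False sorted_wrt_nth_less[of "\<lambda>x y. (x, y) \<in> r" xs]
      by (metis linorder_neqE_nat)
  qed
  then have "set xs \<in> Chains r"
    by (auto simp: Chains_def)
  moreover have "C = set xs" if "C \<in> Chains r" "set xs \<subseteq> C" for C
  proof -
    have "x \<in> set xs" if "x \<in> C" for x
    proof -
      have "x \<in> Field r" "\<forall>y\<in>set xs. (x, y) \<in> r \<or> (y, x) \<in> r"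
        using that \<open>C \<in> Chains r\<close> \<open>set xs \<subseteq> C\<close> by (auto simp: Chains_def Field_def)
      then show ?thesis using R by blast
    qed
    then show ?thesis using \<open>set xs \<subseteq> C\<close> by blast
  qed
  ultimately show "xs \<in> max_chains r"
    using R by (auto simp: max_chains_def)
qed

lemma partial_order_Refl: "Partial_order r \<Longrightarrow> Refl r"
  by (simp add: partial_order_on_def preorder_on_def)

lemma partial_order_refl: "Partial_order r \<Longrightarrow> x \<in> Field r \<Longrightarrow> (x, x) \<in> r"
  by (simp add: partial_order_on_def preorder_on_def refl_on_def)

lemma max_chains_subset_Field:
  "Partial_order r \<Longrightarrow> xs \<in> max_chains r \<Longrightarrow> set xs \<subseteq> Field r"
  by (simp add: max_chains_iff partial_order_Refl)

lemma max_chains_nonempty: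
  "Partial_order r \<Longrightarrow> Field r \<noteq> {} \<Longrightarrow> xs \<in> max_chains r \<Longrightarrow> xs \<noteq> []"
  by (auto simp: max_chains_iff partial_order_Refl)

lemma max_chains_point: "max_chains {(a, a)} = {[a]}"
proof -
  have R: "Refl {(a, a)}" by (auto simp: refl_on_def)
  have "xs = [a]" if "distinct xs" "set xs = {a}" for xs
    using that distinct_card[of xs] by (cases xs) (auto simp: subset_singleton_iff)
  then show ?thesis
    using R by (auto simp: max_chains_iff) blast+
qed

text \<open>Points of different summands are incomparable, so a nonempty chain stays in the summand
  of its first point. Nonempty fields matter: \<open>[]\<close> is a maximal chain of the empty
  poset, but not of its union with a nonempty one.\<close>

lemma max_chains_poset_union:
  assumes P: "Partial_order P" "Field P \<noteq> {}" and Q: "Partial_order Q" "Field Q \<noteq> {}"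
    and disj: "Field P \<inter> Field Q = {}"
  shows "max_chains (poset_union P Q) = max_chains P \<union> max_chains Q"
proof -
  have R: "Refl (poset_union P Q)" "Refl P" "Refl Q"
    using partial_order_Refl partial_order_poset_union[OF P(1) Q(1) disj] P Q by blast+
  have fP: "(x, y) \<in> P \<Longrightarrow> x \<in> Field P \<and> y \<in> Field P" for x y
    by (auto simp: Field_def)
  have fQ: "(x, y) \<in> Q \<Longrightarrow> x \<in> Field Q \<and> y \<in> Field Q" for x y
    by (auto simp: Field_def)
  have iP: "(x, y) \<in> poset_union P Q \<longleftrightarrow> (x, y) \<in> P" if "x \<in> Field P \<or> y \<in> Field P" for x y
    using that fP fQ disj unfolding poset_union_def by blast
  have iQ: "(x, y) \<in> poset_union P Q \<longleftrightarrow> (x, y) \<in> Q" if "x \<in> Field Q \<or> y \<in> Field Q" for x y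
    using that fP fQ disj unfolding poset_union_def by blast
  have eqP: "xs \<in> max_chains (poset_union P Q) \<longleftrightarrow> xs \<in> max_chains P"
    if xs: "xs \<noteq> []" "set xs \<subseteq> Field P" for xs
  proof -
    have "sorted_wrt (\<lambda>x y. (x, y) \<in> poset_union P Q) xs \<longleftrightarrow> sorted_wrt (\<lambda>x y. (x, y) \<in> P) xs"
      using xs by (intro iffI; elim sorted_wrt_mono_rel[rotated]) (auto simp: iP subset_iff)
    moreover have "(\<forall>y\<in>set xs. (x, y) \<in> poset_union P Q \<or> (y, x) \<in> poset_union P Q) \<longleftrightarrow>
        (\<forall>y\<in>set xs. (x, y) \<in> P \<or> (y, x) \<in> P)" for x
      using xs by (auto simp: iP subset_iff)
    moreover have "x \<in> Field P" if "\<forall>y\<in>set xs. (x, y) \<in> P \<or> (y, x) \<in> P" for x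
      using that xs fP by (metis list.set_intros(1) neq_Nil_conv)
    ultimately show ?thesis
      using xs unfolding max_chains_iff[OF R(1)] max_chains_iff[OF R(2)] by auto
  qed
  have eqQ: "xs \<in> max_chains (poset_union P Q) \<longleftrightarrow> xs \<in> max_chains Q"
    if xs: "xs \<noteq> []" "set xs \<subseteq> Field Q" for xs
  proof -
    have "sorted_wrt (\<lambda>x y. (x, y) \<in> poset_union P Q) xs \<longleftrightarrow> sorted_wrt (\<lambda>x y. (x, y) \<in> Q) xs"
      using xs by (intro iffI; elim sorted_wrt_mono_rel[rotated]) (auto simp: iQ subset_iff)
    moreover have "(\<forall>y\<in>set xs. (x, y) \<in> poset_union P Q \<or> (y, x) \<in> poset_union P Q) \<longleftrightarrow>
        (\<forall>y\<in>set xs. (x, y) \<in> Q \<or> (y, x) \<in> Q)" for x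
      using xs by (auto simp: iQ subset_iff)
    moreover have "x \<in> Field Q" if "\<forall>y\<in>set xs. (x, y) \<in> Q \<or> (y, x) \<in> Q" for x
      using that xs fQ by (metis list.set_intros(1) neq_Nil_conv)
    ultimately show ?thesis
      using xs unfolding max_chains_iff[OF R(1)] max_chains_iff[OF R(3)] by auto
  qed
  have split: "xs \<noteq> [] \<and> (set xs \<subseteq> Field P \<or> set xs \<subseteq> Field Q)"
    if xs: "xs \<in> max_chains (poset_union P Q)" for xs
  proof -
    have ne: "xs \<noteq> []"
      using max_chains_nonempty[OF partial_order_poset_union[OF P(1) Q(1) disj] _ xs] P by auto
    then obtain x ys where x: "xs = x # ys" by (cases xs) auto
    have s: "set xs \<subseteq> Field P \<union> Field Q" "\<forall>y\<in>set ys. (x, y) \<in> poset_union P Q"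
      using xs x by (auto simp: max_chains_iff[OF R(1)])
    have "set ys \<subseteq> Field P" if "x \<in> Field P"
    proof
      fix y assume "y \<in> set ys"
      then have "(x, y) \<in> P" using s(2) iP[of x y] that by simp
      then show "y \<in> Field P" using fP by simp
    qed
    moreover have "set ys \<subseteq> Field Q" if "x \<in> Field Q"
    proof
      fix y assume "y \<in> set ys"
      then have "(x, y) \<in> Q" using s(2) iQ[of x y] that by simp
      then show "y \<in> Field Q" using fQ by simp
    qed
    ultimately show ?thesis
      using x s(1) by auto
  qed
  show ?thesis
  proof (intro set_eqI iffI)
    fix xs assume "xs \<in> max_chains (poset_union P Q)"
    then show "xs \<in> max_chains P \<union> max_chains Q"
      by (metis split eqP eqQ UnI1 UnI2)
  next
    fix xs assume "xs \<in> max_chains P \<union> max_chains Q"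
    then show "xs \<in> max_chains (poset_union P Q)"
    proof
      assume "xs \<in> max_chains P"
      then show ?thesis
        using eqP max_chains_nonempty[OF P] max_chains_subset_Field[OF P(1)] by simp
    next
      assume "xs \<in> max_chains Q"
      then show ?thesis
        using eqQ max_chains_nonempty[OF Q] max_chains_subset_Field[OF Q(1)] by simp
    qed
  qed
qed

text \<open>Every point of \<open>P\<close> is comparable with every point of \<open>Q\<close>, so
  maximality of \<open>ys @ zs\<close> can be tested in the two halves separately.\<close>

lemma max_chains_ordinal_sum:
  assumes P: "Partial_order P" and Q: "Partial_order Q" and disj: "Field P \<inter> Field Q = {}"
  shows "max_chains (ordinal_sum P Q) = {ys @ zs | ys zs. ys \<in> max_chains P \<and> zs \<in> max_chains Q}"
proof -
  let ?r = "ordinal_sum P Q"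
  have R: "Refl ?r" "Refl P" "Refl Q"
    using partial_order_Refl partial_order_ordinal_sum[OF P Q disj] P Q by blast+
  have fP: "(x, y) \<in> P \<Longrightarrow> x \<in> Field P \<and> y \<in> Field P" for x y
    by (auto simp: Field_def)
  have fQ: "(x, y) \<in> Q \<Longrightarrow> x \<in> Field Q \<and> y \<in> Field Q" for x y
    by (auto simp: Field_def)
  have iP: "(x, y) \<in> ?r \<longleftrightarrow> (x, y) \<in> P" if "x \<in> Field P" "y \<in> Field P" for x y
    using that fP fQ disj unfolding ordinal_sum_def by blast
  have iQ: "(x, y) \<in> ?r \<longleftrightarrow> (x, y) \<in> Q" if "x \<in> Field Q" "y \<in> Field Q" for x y
    using that fP fQ disj unfolding ordinal_sum_def by blast
  have iPQ: "(x, y) \<in> ?r" if "x \<in> Field P" "y \<in> Field Q" for x y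
    using that by (auto simp: ordinal_sum_def)
  have key: "ys @ zs \<in> max_chains ?r \<longleftrightarrow> ys \<in> max_chains P \<and> zs \<in> max_chains Q"
    if s: "set ys \<subseteq> Field P" "set zs \<subseteq> Field Q" for ys zs
  proof -
    have 1: "sorted_wrt (\<lambda>x y. (x, y) \<in> ?r) ys \<longleftrightarrow> sorted_wrt (\<lambda>x y. (x, y) \<in> P) ys"
      using s by (intro iffI; elim sorted_wrt_mono_rel[rotated]) (auto simp: iP subset_iff)
    have 2: "sorted_wrt (\<lambda>x y. (x, y) \<in> ?r) zs \<longleftrightarrow> sorted_wrt (\<lambda>x y. (x, y) \<in> Q) zs"
      using s by (intro iffI; elim sorted_wrt_mono_rel[rotated]) (auto simp: iQ subset_iff)
    have 3: "(\<forall>y\<in>set ys \<union> set zs. (x, y) \<in> ?r \<or> (y, x) \<in> ?r) \<longleftrightarrow>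
        (\<forall>y\<in>set ys. (x, y) \<in> P \<or> (y, x) \<in> P)" if "x \<in> Field P" for x
      using that s iP iPQ unfolding ball_Un by (meson subsetD)
    have 4: "(\<forall>y\<in>set ys \<union> set zs. (x, y) \<in> ?r \<or> (y, x) \<in> ?r) \<longleftrightarrow>
        (\<forall>y\<in>set zs. (x, y) \<in> Q \<or> (y, x) \<in> Q)" if "x \<in> Field Q" for x
      using that s iQ iPQ unfolding ball_Un by (meson subsetD)
    have 5: "set ys \<inter> set zs = {}" "\<forall>x\<in>set ys. \<forall>y\<in>set zs. (x, y) \<in> ?r"
      using s disj iPQ by blast+
    have 6: "x \<in> set ys \<union> set zs \<longleftrightarrow> x \<in> set ys" if "x \<in> Field P" for x
      using that s disj by auto
    have 7: "x \<in> set ys \<union> set zs \<longleftrightarrow> x \<in> set zs" if "x \<in> Field Q" for x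
      using that s disj by auto
    have 8: "(\<forall>x\<in>Field ?r. (\<forall>y\<in>set ys \<union> set zs. (x, y) \<in> ?r \<or> (y, x) \<in> ?r) \<longrightarrow>
          x \<in> set ys \<union> set zs) \<longleftrightarrow>
        (\<forall>x\<in>Field P. (\<forall>y\<in>set ys. (x, y) \<in> P \<or> (y, x) \<in> P) \<longrightarrow> x \<in> set ys) \<and>
        (\<forall>x\<in>Field Q. (\<forall>y\<in>set zs. (x, y) \<in> Q \<or> (y, x) \<in> Q) \<longrightarrow> x \<in> set zs)"
      unfolding Field_ordinal_sum ball_Un[of "Field P"] using 3 4 6 7 by (simp cong: ball_cong)
    have 9: "set ys \<union> set zs \<subseteq> Field ?r"
      using s by auto
    show ?thesis
      unfolding max_chains_iff[OF R(1)] max_chains_iff[OF R(2)] max_chains_iff[OF R(3)]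
        sorted_wrt_append distinct_append set_append 1 2 8
      using s 5 9 by simp blast
  qed
  have split: "\<exists>ys zs. xs = ys @ zs \<and> set ys \<subseteq> Field P \<and> set zs \<subseteq> Field Q"
    if xs: "xs \<in> max_chains ?r" for xs
  proof -
    let ?ys = "takeWhile (\<lambda>x. x \<in> Field P) xs"
    let ?zs = "dropWhile (\<lambda>x. x \<in> Field P) xs"
    have s: "sorted_wrt (\<lambda>x y. (x, y) \<in> ?r) (?ys @ ?zs)" "set xs \<subseteq> Field P \<union> Field Q"
      using xs by (auto simp: max_chains_iff[OF R(1)])
    \<comment> \<open>The first point outside \<open>Field P\<close> lies in \<open>Q\<close>, and
      no point of \<open>P\<close> is above a point of \<open>Q\<close>, so all later points lie in
      \<open>Q\<close> too.\<close>
    have "set ?zs \<subseteq> Field Q"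
    proof (cases ?zs)
      case (Cons z zs')
      then have z: "z \<notin> Field P" by (metis hd_dropWhile list.distinct(1) list.sel(1))
      moreover have "\<forall>y\<in>set zs'. (z, y) \<in> ?r"
        using s(1) unfolding sorted_wrt_append Cons by simp
      moreover have "z \<in> set xs"
        using Cons set_dropWhileD[of z "\<lambda>x. x \<in> Field P" xs] by simp
      ultimately show ?thesis
        using Cons s(2) fP fQ by (auto simp: ordinal_sum_def)
    next
      case Nil
      show ?thesis unfolding Nil by simp
    qed
    moreover have "set ?ys \<subseteq> Field P"
      by (auto dest: set_takeWhileD)
    ultimately show ?thesis
      by (metis takeWhile_dropWhile_id)
  qed
  show ?thesis
  proof (intro set_eqI iffI)
    fix xs assume xs: "xs \<in> max_chains ?r"
    then obtain ys zs where "xs = ys @ zs" "set ys \<subseteq> Field P" "set zs \<subseteq> Field Q"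
      using split by blast
    then show "xs \<in> {ys @ zs | ys zs. ys \<in> max_chains P \<and> zs \<in> max_chains Q}"
      using key xs by blast
  next
    fix xs assume "xs \<in> {ys @ zs | ys zs. ys \<in> max_chains P \<and> zs \<in> max_chains Q}"
    then show "xs \<in> max_chains ?r"
      using key max_chains_subset_Field[OF P] max_chains_subset_Field[OF Q] by blast
  qed
qed

text \<open>A point comparable with the whole crossed chain is comparable with \<open>a\<close>. If
  it is below \<open>a\<close>, it is below all of \<open>a # ys\<close>, hence already on the first
  chain; if it is above \<open>a\<close>, it is likewise on the second.\<close>

lemma max_chains_crossover:
  assumes r: "Partial_order r"
    and xs: "xs @ a # ys \<in> max_chains r" and xs': "xs' @ a # ys' \<in> max_chains r"
  shows "xs @ a # ys' \<in> max_chains r"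
proof -
  have R: "Refl r" "trans r" "antisym r"
    using r by (auto simp: partial_order_on_def preorder_on_def)
  note A = xs[unfolded max_chains_iff[OF R(1)]] and B = xs'[unfolded max_chains_iff[OF R(1)]]
  have low: "(x, a) \<in> r" if "x \<in> set xs" for x
    using A that by (auto simp: sorted_wrt_append)
  have up: "(a, y) \<in> r" if "y \<in> set ys" for y
    using A that by (auto simp: sorted_wrt_append)
  have low': "(x, a) \<in> r" if "x \<in> set xs'" for x
    using B that by (auto simp: sorted_wrt_append)
  have up': "(a, y) \<in> r" if "y \<in> set ys'" for y
    using B that by (auto simp: sorted_wrt_append)
  have "set xs \<inter> set ys' = {}"
    using low up' R(3) A by (auto dest: antisymD)
  then have d: "distinct (xs @ a # ys')"
    using A B by auto
  have "sorted_wrt (\<lambda>x y. (x, y) \<in> r) (xs @ a # ys')"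
    using A B low up' R(2) by (auto simp: sorted_wrt_append dest: transD)
  moreover have "x \<in> set (xs @ a # ys')"
    if x: "x \<in> Field r" "\<forall>y\<in>set (xs @ a # ys'). (x, y) \<in> r \<or> (y, x) \<in> r" for x
  proof -
    consider "(x, a) \<in> r" | "(a, x) \<in> r" using x by auto
    then show ?thesis
    proof cases
      case 1
      then have "\<forall>y\<in>set (xs @ a # ys). (x, y) \<in> r \<or> (y, x) \<in> r"
        using x up R(2) by (auto dest: transD)
      then have "x \<in> set (xs @ a # ys)" using A x by blast
      then show ?thesis using up 1 R(3) by (auto dest: antisymD)
    next
      case 2
      then have "\<forall>y\<in>set (xs' @ a # ys'). (x, y) \<in> r \<or> (y, x) \<in> r"
        using x low' R(2) by (auto dest: transD)
      then have "x \<in> set (xs' @ a # ys')" using B x by blast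
      then show ?thesis using low' 2 R(3) by (auto dest: antisymD)
    qed
  qed
  ultimately show ?thesis
    using d A B unfolding max_chains_iff[OF R(1)] by auto
qed

text \<open>Order relations of \<open>P\<close> can thus be tested along maximal chains, where the
  words of a shuffle are known.\<close>

lemma sp_poset_max_chain_through:
  assumes "sp_poset P"
  shows "(p, q) \<in> P \<Longrightarrow> \<exists>M\<in>max_chains P. p \<in> set M \<and> q \<in> set M"
  using assms
proof (induction arbitrary: p q)
  case (sp_point a)
  then show ?case by (auto simp: max_chains_point)
next
  case (sp_union P Q)
  then have "max_chains (poset_union P Q) = max_chains P \<union> max_chains Q"
    by (simp add: max_chains_poset_union sp_poset_partial_order)
  then show ?case
    using sp_union.IH[of p q] sp_union.prems by (auto simp: in_poset_union)
next
  case (sp_osum P Q)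
  have mc: "max_chains (ordinal_sum P Q) = {ys @ zs | ys zs. ys \<in> max_chains P \<and> zs \<in> max_chains Q}"
    using sp_osum by (simp add: max_chains_ordinal_sum sp_poset_partial_order)
  have refl: "(x, x) \<in> P" if "x \<in> Field P" for x
    using that sp_poset_partial_order(1)[OF sp_osum(1)] by (simp add: partial_order_refl)
  have refl': "(x, x) \<in> Q" if "x \<in> Field Q" for x
    using that sp_poset_partial_order(1)[OF sp_osum(2)] by (simp add: partial_order_refl)
  \<comment> \<open>A chain of one summand has to be completed by some maximal chain of the other;
    these points provide one.\<close>
  obtain x y where xy: "x \<in> Field P" "y \<in> Field Q"
    using sp_poset_partial_order(3)[OF sp_osum(1)] sp_poset_partial_order(3)[OF sp_osum(2)]
    by (meson ex_in_conv)
  have "\<exists>M\<in>max_chains P. \<exists>N\<in>max_chains Q. p \<in> set M \<union> set N \<and> q \<in> set M \<union> set N"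
  proof -
    consider "(p, q) \<in> P" | "(p, q) \<in> Q" | "p \<in> Field P" "q \<in> Field Q"
      using sp_osum.prems by (auto simp: ordinal_sum_def)
    then show ?thesis
    proof cases
      case 1
      then show ?thesis
        using sp_osum.IH(1)[OF 1] sp_osum.IH(2)[OF refl'[OF xy(2)]] by (meson UnI1)
    next
      case 2
      then show ?thesis
        using sp_osum.IH(2)[OF 2] sp_osum.IH(1)[OF refl[OF xy(1)]] by (meson UnI2)
    next
      case 3
      then show ?thesis
        using sp_osum.IH(1)[OF refl[OF 3(1)]] sp_osum.IH(2)[OF refl'[OF 3(2)]] by (meson UnI1 UnI2)
    qed

  qed
  then obtain M N where "M \<in> max_chains P" "N \<in> max_chains Q"
      "p \<in> set M \<union> set N" "q \<in> set M \<union> set N"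
    by blast
  then have "M @ N \<in> max_chains (ordinal_sum P Q)" "p \<in> set (M @ N)" "q \<in> set (M @ N)"
    unfolding mc by auto
  then show ?case by blast
qed

section \<open>Minimal and maximal points of disjoint unions and ordinal sums\<close>

lemma minimal_points_poset_union:
  "Field P \<inter> Field Q = {} \<Longrightarrow>
    minimal_points (poset_union P Q) = minimal_points P \<union> minimal_points Q"
  by (auto simp: minimal_points_def poset_union_def Field_def)

lemma maximal_points_poset_union:
  "Field P \<inter> Field Q = {} \<Longrightarrow>
    maximal_points (poset_union P Q) = maximal_points P \<union> maximal_points Q"
  by (auto simp: maximal_points_def poset_union_def Field_def)

lemma minimal_points_ordinal_sum:
  assumes "Field P \<inter> Field Q = {}" "Field P \<noteq> {}"
  shows "minimal_points (ordinal_sum P Q) = minimal_points P"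
proof -
  obtain x where "x \<in> Field P" using assms by blast
  moreover have "(u, v) \<in> Q \<Longrightarrow> v \<in> Field Q" "(u, v) \<in> P \<Longrightarrow> v \<in> Field P" for u v
    by (auto simp: Field_def)
  ultimately show ?thesis
    using assms(1) unfolding minimal_points_def Field_ordinal_sum
    by (simp add: in_ordinal_sum set_eq_iff) blast
qed

lemma maximal_points_ordinal_sum:
  assumes "Field P \<inter> Field Q = {}" "Field Q \<noteq> {}"
  shows "maximal_points (ordinal_sum P Q) = maximal_points Q"
proof -
  obtain x where "x \<in> Field Q" using assms by blast
  moreover have "(u, v) \<in> Q \<Longrightarrow> u \<in> Field Q" "(u, v) \<in> P \<Longrightarrow> u \<in> Field P" for u v
    by (auto simp: Field_def)
  ultimately show ?thesis
    using assms(1) unfolding maximal_points_def Field_ordinal_sum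
    by (simp add: in_ordinal_sum set_eq_iff) blast
qed

lemma extremal_points_subset:
  "minimal_points P \<subseteq> Field P" "maximal_points P \<subseteq> Field P"
  by (auto simp: minimal_points_def maximal_points_def)


section \<open>Words along maximal chains\<close>

text \<open>The chain letters run from \<open>Suc l\<close> to \<open>u\<close>, and
  \<open>h p\<close> is the last one before \<open>p\<close> (or \<open>l\<close> if there is none).
  Leaving \<open>l\<close> out lets words over adjacent segments be concatenated without repeating a
  letter. The recurring hypothesis \<open>sorted (l # map h M @ [u])\<close> keeps the runs from
  overlapping.\<close>

fun chain_word :: "nat \<Rightarrow> ('a \<Rightarrow> nat) \<Rightarrow> 'a list \<Rightarrow> nat \<Rightarrow> ('a + nat) list" where
  "chain_word l h [] u = map Inr [Suc l..<Suc u]"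
| "chain_word l h (p # M) u = map Inr [Suc l..<Suc (h p)] @ Inl p # chain_word (h p) h M u"

abbreviation count_Inr :: "('a + 'b) list \<Rightarrow> nat" where
  "count_Inr w \<equiv> length (filter (\<lambda>x. \<not> isl x) w)"

lemma chain_word_cong:
  "(\<And>p. p \<in> set M \<Longrightarrow> h p = k p) \<Longrightarrow> chain_word l h M u = chain_word l k M u"
  by (induction M arbitrary: l) auto

lemma upt_Suc_append:
  "l \<le> m \<Longrightarrow> m \<le> u \<Longrightarrow> [Suc l..<Suc m] @ [Suc m..<Suc u] = [Suc l..<Suc u]"
  using upt_add_eq_append[of "Suc l" "Suc m" "u - m"] by simp

lemma upt_Suc_append_map:
  "l \<le> m \<Longrightarrow> m \<le> u \<Longrightarrow>
    map f [Suc l..<Suc m] @ map f [Suc m..<Suc u] @ w = map f [Suc l..<Suc u] @ w"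
  using upt_Suc_append[of l m u] by (metis append.assoc map_append)

text \<open>Serves at the junction of two segments and when a word is extended by a single letter:
  the extra letters merge with the first run.\<close>

lemma map_Inr_append_chain_word:
  assumes "l \<le> m" "sorted (m # map h M @ [u])"
  shows "map Inr [Suc l..<Suc m] @ chain_word m h M u = chain_word l h M u"
proof (cases M)
  case Nil
  then show ?thesis
    using assms upt_Suc_append_map[of l m u Inr "[]"] by (simp del: upt_Suc)
next
  case (Cons p M')
  then show ?thesis
    using assms upt_Suc_append_map[of l m "h p" Inr] by (simp del: upt_Suc)
qed

lemma chain_word_append:
  assumes "sorted (l # map h M @ [m])" "sorted (m # map h N @ [u])"
  shows "chain_word l h M m @ chain_word m h N u = chain_word l h (M @ N) u"
  using assms(1)
proof (induction M arbitrary: l)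
  case Nil
  then show ?case
    using map_Inr_append_chain_word[OF _ assms(2)] by (simp del: upt_Suc)
next
  case (Cons p M)
  then show ?case by (simp del: upt_Suc)
qed

lemma append_in_shuffles: "zs \<in> shuffles xs ys \<Longrightarrow> as @ zs \<in> shuffles xs (as @ ys)"
  by (induction as) (auto intro: Cons_in_shuffles_rightI)

lemma chain_word_in_shuffles:
  "sorted (l # map h M @ [u]) \<Longrightarrow>
    chain_word l h M u \<in> shuffles (map Inl M) (map Inr [Suc l..<Suc u])"
proof (induction M arbitrary: l)
  case Nil
  then show ?case by simp
next
  case (Cons p M)
  then have le: "l \<le> h p" "h p \<le> u"
    by auto
  have "Inl p # chain_word (h p) h M u \<in>
      shuffles (Inl p # map Inl M) (map Inr [Suc (h p)..<Suc u])"
    using Cons by (intro Cons_in_shuffles_leftI Cons.IH) auto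
  from append_in_shuffles[OF this, of "map Inr [Suc l..<Suc (h p)]"]
  show ?case
    using upt_Suc_append[OF le] by (simp del: upt_Suc flip: map_append)
qed

text \<open>Reading the word from the left, \<open>l\<close> is the last chain letter passed: an
  initial letter \<open>Inl p\<close> gives \<open>p\<close> the height \<open>l\<close>, an initial
  letter \<open>Inr (Suc l)\<close> raises \<open>l\<close> by one.\<close>

lemma shuffles_chain_word:
  assumes "w \<in> shuffles (map Inl M) (map Inr [Suc l..<Suc u])" "distinct M" "l \<le> u"
  obtains k where "w = chain_word l k M u" "sorted (l # map k M @ [u])"
proof -
  have "\<exists>k. w = chain_word l k M u \<and> sorted (l # map k M @ [u])"
    using assms
  proof (induction w arbitrary: M l)
    case Nil
    then show ?case by (auto simp: Nil_in_shuffles)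
  next
    case (Cons x w)
    consider p M' where "M = p # M'" "x = Inl p"
        "w \<in> shuffles (map Inl M') (map Inr [Suc l..<Suc u])"
      | ys where "map Inr [Suc l..<Suc u] = x # ys" "w \<in> shuffles (map Inl M) ys"
    proof -
      from Cons.prems(1)[unfolded Cons_in_shuffles_iff] show thesis
      proof (elim disjE conjE)
        assume M: "map Inl M \<noteq> []" "hd (map Inl M) = x"
          "w \<in> shuffles (tl (map Inl M)) (map Inr [Suc l..<Suc u])"
        then obtain p M' where "M = p # M'"
          by (cases M) auto
        then show thesis using M that(1)[of p M'] by (simp del: upt_Suc)
      next
        assume ys: "map Inr [Suc l..<Suc u] \<noteq> ([] :: ('a + nat) list)"
          "hd (map Inr [Suc l..<Suc u]) = x"
          "w \<in> shuffles (map Inl M) (tl (map Inr [Suc l..<Suc u]))"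
        then show thesis using that(2) by (metis list.collapse)
      qed
    qed
    then show ?case
    proof cases
      case 1
      then obtain k where k: "w = chain_word l k M' u" "sorted (l # map k M' @ [u])"
        using Cons.IH[of M' l] Cons.prems by auto
      \<comment> \<open>Since \<open>M\<close> is distinct, changing the value at \<open>p\<close>
        leaves the rest of the word unchanged.\<close>
      define k' where "k' = k(p := l)"
      have "p \<notin> set M'"
        using 1 Cons.prems by auto
      then have "chain_word l k' M' u = w" "map k' M' = map k M'" "k' p = l"
        using k by (auto simp: k'_def intro!: chain_word_cong)
      then show ?thesis
        using 1 k(2) by (intro exI[of _ k']) (simp del: upt_Suc cong: map_cong)
    next
      case 2
      then have lu: "l < u"
        by (cases "l < u") auto
      then have "[Suc l..<Suc u] = Suc l # [Suc (Suc l)..<Suc u]"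
        by (simp add: upt_rec del: upt_Suc)
      then have x: "x = Inr (Suc l)" "ys = map Inr [Suc (Suc l)..<Suc u]"
        using 2 by (auto simp del: upt_Suc)
      then obtain k where k: "w = chain_word (Suc l) k M u" "sorted (Suc l # map k M @ [u])"
        using Cons.IH[of M "Suc l"] Cons.prems 2 lu by (auto simp del: upt_Suc)
      have "x # w = chain_word l k M u"
        using map_Inr_append_chain_word[of l "Suc l" k M u] k x by simp
      then show ?thesis
        using k by (intro exI[of _ k]) auto
    qed
  qed
  then show thesis using that by blast
qed

text \<open>A letter \<open>Inl p\<close> cannot occur inside the block of \<open>Inr\<close>
  letters, so it is the one right after the block or a later one.\<close>

lemma map_Inr_append_Inl_eq:
  assumes "map Inr xs @ Inl q # W = U @ Inl p # V"
  shows "U = map Inr xs \<and> q = p \<and> W = V \<or>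
    (\<exists>U'. U = map Inr xs @ Inl q # U' \<and> W = U' @ Inl p # V)"
  using assms
proof (induction xs arbitrary: U)
  case Nil
  then show ?case by (cases U) auto
next
  case (Cons x xs)
  then show ?case by (cases U) auto
qed

lemma count_Inr_map_Inr [simp]: "count_Inr (map Inr xs) = length xs"
  by (induction xs) auto

text \<open>Recovers a height from the word alone, by counting the chain letters before
  \<open>p\<close>. Such counts can be compared between chains, whatever functions were used to
  write down their words.\<close>

lemma chain_word_split:
  "chain_word l h M u = U @ Inl p # V \<Longrightarrow> sorted (l # map h M) \<Longrightarrow> l + count_Inr U = h p"
proof (induction M arbitrary: l U)
  case Nil
  then have "Inl p \<in> set (map Inr [Suc l..<Suc u])"
    by (simp del: upt_Suc)
  then show ?case by auto
next
  case (Cons q M)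
  from map_Inr_append_Inl_eq[OF Cons.prems(1)[unfolded chain_word.simps]]
  consider "U = map Inr [Suc l..<Suc (h q)]" "q = p"
    | U' where "U = map Inr [Suc l..<Suc (h q)] @ Inl q # U'"
        "chain_word (h q) h M u = U' @ Inl p # V"
    by blast
  then show ?case
  proof cases
    case 1
    then show ?thesis using Cons.prems(2) by (simp del: upt_Suc)
  next
    case 2
    then show ?thesis using Cons.prems(2) Cons.IH[of "h q" U'] by (simp del: upt_Suc)
  qed
qed

lemma count_Inr_shuffle:
  assumes "w \<in> shuffles (map Inl M) (map Inr xs)"
  shows "count_Inr w = length xs"
proof -
  have "filter (\<lambda>x. \<not> isl x) w \<in>
      shuffles (filter (\<lambda>x. \<not> isl x) (map Inl M)) (filter (\<lambda>x. \<not> isl x) (map Inr xs))"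
    using assms filter_shuffles[of "\<lambda>x. \<not> isl x"] by blast
  then have "filter (\<lambda>x. \<not> isl x) w = map Inr xs"
    by (simp add: filter_map comp_def)
  then show ?thesis
    by (metis length_map)
qed

lemma set_chain_word_Inl: "Inl p \<in> set (chain_word l h M u) \<longleftrightarrow> p \<in> set M"
  by (induction M arbitrary: l) (auto simp del: upt_Suc)


section \<open>Shuffles and isotone maps\<close>

definition isotone :: "'a rel \<Rightarrow> nat \<Rightarrow> nat \<Rightarrow> ('a \<Rightarrow> nat) \<Rightarrow> bool" where
  "isotone P l u h \<longleftrightarrow> h ` Field P \<subseteq> {l..u} \<and> (\<forall>(p, q)\<in>P. h p \<le> h q)"

lemma isotone_sorted:
  assumes "Partial_order P" "isotone P l u h" "l \<le> u" "M \<in> max_chains P"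
  shows "sorted (l # map h M @ [u])"
proof -
  have M: "sorted_wrt (\<lambda>x y. (x, y) \<in> P) M" "set M \<subseteq> Field P"
    using assms by (auto simp: max_chains_iff partial_order_Refl)
  then have "sorted (map h M)"
    unfolding sorted_map using assms(2)
    by (auto simp: isotone_def intro: sorted_wrt_mono_rel[of M "\<lambda>x y. (x, y) \<in> P"])
  moreover have "\<forall>p\<in>set M. l \<le> h p \<and> h p \<le> u"
    using M(2) assms(2) unfolding isotone_def by fastforce
  ultimately show ?thesis
    using assms(3) by (auto simp: sorted_append)
qed

lemma shuffle_count_before:
  assumes sh: "is_shuffle_via P n A lab \<beta>"
    and C: "X @ a # Y \<in> max_chains A" and C': "X' @ a # Y' \<in> max_chains A"
  shows "count_Inr (map lab X) = count_Inr (map lab X')"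
proof -
  have A: "Partial_order A" and \<beta>: "\<beta> ` max_chains P = max_chains A"
    and lab: "\<And>M. M \<in> max_chains P \<Longrightarrow>
      map lab (\<beta> M) \<in> shuffles (map Inl M) (map Inr [1..<Suc n])"
    using sh by (auto simp: is_shuffle_via_def bij_betw_def)
  \<comment> \<open>Since \<open>\<beta>\<close> is onto, this also applies to the crossed chain,
    which is not given as the image of a chain of \<open>P\<close>.\<close>
  have total: "count_Inr (map lab C) = n" if "C \<in> max_chains A" for C
  proof -
    have "C \<in> \<beta> ` max_chains P"
      using that \<beta> by simp
    then obtain M where "M \<in> max_chains P" "C = \<beta> M"
      by blast
    then show ?thesis
      using count_Inr_shuffle[OF lab[of M]] by simp
  qed
  \<comment> \<open>The crossed chain and \<open>C'\<close> share the tail from \<open>a\<close> on,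
    which cancels in the two totals.\<close>
  show ?thesis
    using total[OF C'] total[OF max_chains_crossover[OF A C C']] by simp
qed

text \<open>With equal bijections this makes the height a function on \<open>P\<close>; with equal
  chains it serves when a bijection comes out of \<open>shuffle_equiv\<close>. The two chains of
  \<open>A\<close> meet because \<open>p\<close> labels a single point.\<close>

lemma shuffle_height_unique:
  assumes sh: "is_shuffle_via P n A lab \<beta>" "is_shuffle_via P n A lab \<beta>'"
    and M: "M \<in> max_chains P" "M' \<in> max_chains P" "p \<in> set M" "p \<in> set M'" "p \<in> Field P"
    and k: "map lab (\<beta> M) = chain_word 0 k M n" "sorted (0 # map k M @ [n])"
    and k': "map lab (\<beta>' M') = chain_word 0 k' M' n" "sorted (0 # map k' M' @ [n])"
  shows "k p = k' p"
proof -
  have A: "Partial_order A" and unique: "\<exists>!a. a \<in> Field A \<and> lab a = Inl p"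
    and \<beta>: "\<beta> M \<in> max_chains A" "\<beta>' M' \<in> max_chains A"
    using sh M by (auto simp: is_shuffle_via_def bij_betw_def)
  have "Inl p \<in> lab ` set (\<beta> M)" "Inl p \<in> lab ` set (\<beta>' M')"
    using k(1) k'(1) M by (metis set_chain_word_Inl set_map)+
  then obtain a a' where a: "a \<in> set (\<beta> M)" "lab a = Inl p" "a' \<in> set (\<beta>' M')" "lab a' = Inl p"
    by (metis imageE)
  then have "a = a'"
    using unique max_chains_subset_Field[OF A] \<beta> by blast
  with a obtain X Y X' Y' where XY: "\<beta> M = X @ a # Y" "\<beta>' M' = X' @ a # Y'"
    by (metis split_list)
  have "0 + count_Inr (map lab X) = k p"
    using k XY a by (intro chain_word_split[where M = M and u = n and V = "map lab Y"])
      (auto simp: sorted_append)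
  moreover have "0 + count_Inr (map lab X') = k' p"
    using k' XY a \<open>a = a'\<close>
    by (intro chain_word_split[where M = M' and u = n and V = "map lab Y'"])
      (auto simp: sorted_append)
  ultimately show ?thesis
    using shuffle_count_before[OF sh(1)] \<beta> XY by metis
qed

lemma shuffle_isotone:
  assumes P: "sp_poset P" and sh: "is_shuffle_via P n A lab \<beta>"
  obtains h where "isotone P 0 n h" "\<And>M. M \<in> max_chains P \<Longrightarrow> map lab (\<beta> M) = chain_word 0 h M n"
proof -
  note po = sp_poset_partial_order(1)[OF P]
  have "\<forall>M\<in>max_chains P. \<exists>k. map lab (\<beta> M) = chain_word 0 k M n \<and> sorted (0 # map k M @ [n])"
  proof
    fix M assume M: "M \<in> max_chains P"
    then have "map lab (\<beta> M) \<in> shuffles (map Inl M) (map Inr [Suc 0..<Suc n])" "distinct M"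
      using sh by (auto simp: is_shuffle_via_def max_chains_def simp del: upt_Suc)
    then show "\<exists>k. map lab (\<beta> M) = chain_word 0 k M n \<and> sorted (0 # map k M @ [n])"
      by (meson le0 shuffles_chain_word)
  qed
  then obtain k where k: "\<And>M. M \<in> max_chains P \<Longrightarrow> map lab (\<beta> M) = chain_word 0 (k M) M n"
      "\<And>M. M \<in> max_chains P \<Longrightarrow> sorted (0 # map (k M) M @ [n])"
    by metis
  \<comment> \<open>Any maximal chain through \<open>p\<close> may be chosen, as heights do not
    depend on the chain; off \<open>Field P\<close> the value is arbitrary.\<close>
  define h where "h p = k (SOME M. M \<in> max_chains P \<and> p \<in> set M) p" for p
  have h: "k M p = h p" if M: "M \<in> max_chains P" "p \<in> set M" for M p
  proof -
    have "(SOME M. M \<in> max_chains P \<and> p \<in> set M) \<in> max_chains P \<and>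
        p \<in> set (SOME M. M \<in> max_chains P \<and> p \<in> set M)"
      using M by (metis (mono_tags, lifting) someI_ex)
    moreover have "p \<in> Field P"
      using max_chains_subset_Field[OF po] M by blast
    ultimately show ?thesis
      unfolding h_def using shuffle_height_unique[OF sh sh] M k by blast
  qed
  have le: "h p \<le> h q \<and> h q \<le> n" if pq: "(p, q) \<in> P" for p q
  proof -
    obtain M where M: "M \<in> max_chains P" "p \<in> set M" "q \<in> set M"
      using sp_poset_max_chain_through[OF P pq] by blast
    have eq: "map (k M) M = map h M"
      using h M by simp
    have s: "sorted_wrt (\<lambda>x y. (x, y) \<in> P) M"
      using M by (simp add: max_chains_def)
    obtain i j where ij: "i < length M" "j < length M" "p = M ! i" "q = M ! j"
      using M by (metis in_set_conv_nth)
    \<comment> \<open>If \<open>M\<close> lists \<open>q\<close> before \<open>p\<close>,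
      antisymmetry identifies the two points.\<close>
    have "i \<le> j \<or> p = q"
    proof (cases "j < i")
      case True
      then have "(q, p) \<in> P"
        using sorted_wrt_nth_less[OF s] ij by simp
      then show ?thesis
        using pq po by (auto simp: partial_order_on_def dest: antisymD)
    qed simp
    moreover have "sorted (map h M @ [n])"
      using k(2)[OF M(1)] unfolding eq by simp
    then have "sorted (map h M)" "h q \<le> n"
      using M by (auto simp: sorted_append)
    ultimately show ?thesis
      using ij sorted_nth_mono[of "map h M" i j] by auto
  qed
  have "isotone P 0 n h"
    using le le[OF partial_order_refl[OF po]] by (auto simp: isotone_def)
  moreover have "map lab (\<beta> M) = chain_word 0 h M n" if M: "M \<in> max_chains P" for M
    using k(1)[OF M] chain_word_cong[of M "k M" h] h[OF M] by simp
  ultimately show thesis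
    using that by blast
qed

section \<open>Realizing isotone maps by shuffles\<close>

text \<open>As in \<^const>\<open>is_shuffle_via\<close>, but for a segment \<open>{Suc l..u}\<close> of the chain, with prescribed label words.\<close>

definition realizes ::
  "'a rel \<Rightarrow> nat \<Rightarrow> nat \<Rightarrow> ('a \<Rightarrow> nat) \<Rightarrow> nat rel \<Rightarrow> (nat \<Rightarrow> 'a + nat) \<Rightarrow> ('a list \<Rightarrow> nat list) \<Rightarrow> bool"
  where "realizes P l u h A lab \<beta> \<longleftrightarrow>
    Partial_order A \<and> finite (Field A) \<and>
    lab ` Field A \<subseteq> Inl ` Field P \<union> Inr ` {Suc l..u} \<and>
    (\<forall>p\<in>Field P. \<exists>!a. a \<in> Field A \<and> lab a = Inl p) \<and>
    card (minimal_points A) = card (minimal_points P) \<and>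
    card (maximal_points A) = card (maximal_points P) \<and>
    bij_betw \<beta> (max_chains P) (max_chains A) \<and>
    (\<forall>M\<in>max_chains P. map lab (\<beta> M) = chain_word l h M u)"

text \<open>Over a single point a shuffle is a chain; it is realized on an interval of natural
  numbers, whose left end \<open>N\<close> keeps it away from other summands.\<close>

lemma max_chains_interval:
  fixes N m :: nat
  assumes "N \<le> m"
  shows "max_chains {(x, y). N \<le> x \<and> x \<le> y \<and> y \<le> m} = {[N..<Suc m]}" (is "max_chains ?A = _")
    and "Partial_order {(x, y). N \<le> x \<and> x \<le> y \<and> y \<le> m}"
    and "Field {(x, y). N \<le> x \<and> x \<le> y \<and> y \<le> m} = {N..m}"
    and "minimal_points {(x, y). N \<le> x \<and> x \<le> y \<and> y \<le> m} = {N}"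
    and "maximal_points {(x, y). N \<le> x \<and> x \<le> y \<and> y \<le> m} = {m}"
proof -
  show F: "Field ?A = {N..m}"
    by (auto simp: Field_def)
  show PO: "Partial_order ?A"
    unfolding partial_order_on_def preorder_on_def F
    by (auto simp: refl_on_def trans_def antisym_def)
  have "xs = [N..<Suc m]" if "sorted_wrt (\<lambda>x y. (x, y) \<in> ?A) xs" "distinct xs" "set xs = {N..m}" for xs
  proof -
    have "sorted xs"
      using that(1) by (rule sorted_wrt_mono_rel[rotated]) auto
    then show ?thesis
      using that(2,3) by (intro sorted_distinct_set_unique)
        (simp_all add: atLeastLessThanSuc_atLeastAtMost del: upt_Suc)
  qed
  note eq = this
  have sorted: "sorted_wrt (\<lambda>x y. (x, y) \<in> ?A) [N..<Suc m]"
    by (rule sorted_wrt_mono_rel[OF _ sorted_wrt_upt]) auto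
  have set: "set [N..<Suc m] = {N..m}"
    by auto
  have total: "(x, y) \<in> ?A \<or> (y, x) \<in> ?A" if "x \<in> {N..m}" "y \<in> {N..m}" for x y
    using that by auto
  note iff = max_chains_iff[OF partial_order_Refl[OF PO], unfolded F]
  show "max_chains ?A = {[N..<Suc m]}"
  proof (intro equalityI subsetI)
    fix xs assume "xs \<in> max_chains ?A"
    then have xs: "distinct xs" "sorted_wrt (\<lambda>x y. (x, y) \<in> ?A) xs" "set xs \<subseteq> {N..m}"
      "\<forall>x\<in>{N..m}. (\<forall>y\<in>set xs. (x, y) \<in> ?A \<or> (y, x) \<in> ?A) \<longrightarrow> x \<in> set xs"
      unfolding iff by blast+
    have "x \<in> set xs" if x: "x \<in> {N..m}" for x
    proof -
      have "\<forall>y\<in>set xs. (x, y) \<in> ?A \<or> (y, x) \<in> ?A"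
        using total[OF x] xs(3) by (meson subsetD)
      then show ?thesis
        using xs(4) x by blast
    qed
    then have "set xs = {N..m}"
      using xs(3) by blast
    then show "xs \<in> {[N..<Suc m]}"
      using eq xs by blast
  next
    fix xs assume "xs \<in> {[N..<Suc m]}"
    then have xs: "xs = [N..<Suc m]" by blast
    show "xs \<in> max_chains ?A"
      unfolding xs iff set using sorted by (simp del: upt_Suc)
  qed
  show "minimal_points ?A = {N}" "maximal_points ?A = {m}"
    unfolding minimal_points_def maximal_points_def F using assms by force+
qed

lemma map_nth_shift: "N + length w = m \<Longrightarrow> map (\<lambda>x. w ! (x - N)) [N..<m] = w"
  by (intro nth_equalityI) auto

lemma chain_word_distinct: "distinct M \<Longrightarrow> sorted (l # map h M @ [u]) \<Longrightarrow> distinct (chain_word l h M u)"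
  using distinct_disjoint_shuffles[OF _ _ _ chain_word_in_shuffles[of l h M u]]
  by (force simp: distinct_map simp del: upt_Suc)

lemma ex1_image_inj_on:
  assumes "y \<in> f ` S" "inj_on f S"
  shows "\<exists>!x. x \<in> S \<and> f x = y"
  using assms by (auto dest: inj_onD)

lemma realizes_point:
  assumes "isotone {(a, a)} l u h"
  shows "\<exists>A lab \<beta>. realizes {(a, a)} l u h A lab \<beta> \<and> Field A \<subseteq> {N..}"
proof -
  \<comment> \<open>The word has \<open>u - l\<close> chain letters and the letter for
    \<open>a\<close>, hence \<open>u - l + 1\<close> positions; the letter at position
    \<open>x - N\<close> labels the point \<open>x\<close>.\<close>
  let ?A = "{(x, y). N \<le> x \<and> x \<le> y \<and> y \<le> N + (u - l)}"
  let ?w = "chain_word l h [a] u"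
  let ?lab = "\<lambda>x. ?w ! (x - N)"
  let ?xs = "[N..<Suc (N + (u - l))]"
  have h: "l \<le> h a" "h a \<le> u"
    using assms by (auto simp: isotone_def)
  then have lab: "map ?lab ?xs = ?w"
    by (intro map_nth_shift) (simp del: upt_Suc)
  note A = max_chains_interval[of N "N + (u - l)", OF le_add1]
  have set: "set ?xs = {N..N + (u - l)}"
    by auto
  have d: "distinct (map ?lab ?xs)"
    unfolding lab using h by (intro chain_word_distinct) auto
  have labs: "?lab ` {N..N + (u - l)} = set ?w"
    unfolding set[symmetric] set_map[symmetric] lab ..
  then have "Inl a \<in> ?lab ` {N..N + (u - l)}"
    by simp
  moreover have "inj_on ?lab {N..N + (u - l)}"
    using d unfolding distinct_map set by blast
  ultimately have "\<exists>!x. x \<in> {N..N + (u - l)} \<and> ?lab x = Inl a"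
    by (rule ex1_image_inj_on)
  moreover have "set ?w \<subseteq> Inl ` {a} \<union> Inr ` {Suc l..u}"
    using h by (auto simp del: upt_Suc)
  moreover have "minimal_points {(a, a)} = {a}" "maximal_points {(a, a)} = {a}"
    by (auto simp: minimal_points_def maximal_points_def)
  ultimately have "realizes {(a, a)} l u h ?A ?lab (\<lambda>_. ?xs)"
    unfolding realizes_def max_chains_point
    using lab A labs by (simp add: bij_betw_def del: upt_Suc chain_word.simps)
  then show ?thesis
    using A by (intro exI[of _ ?A] exI) auto
qed

lemma bij_betw_if_Un:
  assumes "bij_betw f A C" "bij_betw g B D" "A \<inter> B = {}" "C \<inter> D = {}"
  shows "bij_betw (\<lambda>x. if x \<in> A then f x else g x) (A \<union> B) (C \<union> D)"
proof (rule bij_betw_combine[OF _ _ assms(4)])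
  show "bij_betw (\<lambda>x. if x \<in> A then f x else g x) A C"
    using assms(1) by (simp cong: bij_betw_cong)
  have "x \<notin> A" if "x \<in> B" for x
    using assms(3) that by blast
  then show "bij_betw (\<lambda>x. if x \<in> A then f x else g x) B D"
    using assms(2) by (simp cong: bij_betw_cong)
qed

text \<open>The \<open>Inl\<close> labels of each side stay within its own summand, so no point of
  \<open>FB\<close> can carry the label of a point of \<open>FP\<close>, nor conversely. The
  \<open>Inr\<close> labels may recur on both sides.\<close>

lemma Inl_label_combine:
  assumes A: "lab1 ` FA \<subseteq> Inl ` FP \<union> Inr ` I" "\<forall>p\<in>FP. \<exists>!a. a \<in> FA \<and> lab1 a = Inl p"
    and B: "lab2 ` FB \<subseteq> Inl ` FQ \<union> Inr ` J" "\<forall>p\<in>FQ. \<exists>!a. a \<in> FB \<and> lab2 a = Inl p"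
    and disj: "FA \<inter> FB = {}" "FP \<inter> FQ = {}"
  defines "lab \<equiv> \<lambda>a. if a \<in> FA then lab1 a else lab2 a"
  shows "\<forall>p\<in>FP \<union> FQ. \<exists>!a. a \<in> FA \<union> FB \<and> lab a = Inl p"
proof
  fix p assume p: "p \<in> FP \<union> FQ"
  have labB: "lab b = lab2 b" "b \<notin> FA" if "b \<in> FB" for b
    using that disj by (auto simp: lab_def)
  have notB: "lab2 b \<noteq> Inl p" if "b \<in> FB" "p \<in> FP" for b
    using that B(1) disj by fastforce
  have notA: "lab1 b \<noteq> Inl p" if "b \<in> FA" "p \<in> FQ" for b
    using that A(1) disj by fastforce
  show "\<exists>!a. a \<in> FA \<union> FB \<and> lab a = Inl p"
  proof (cases "p \<in> FP")
    case True
    then have "a \<in> FA \<union> FB \<and> lab a = Inl p \<longleftrightarrow> a \<in> FA \<and> lab1 a = Inl p" for a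
      using labB notB by (auto simp: lab_def)
    then show ?thesis using A(2) True by simp
  next
    case False
    then have "p \<in> FQ" using p by blast
    then have "a \<in> FA \<union> FB \<and> lab a = Inl p \<longleftrightarrow> a \<in> FB \<and> lab2 a = Inl p" for a
      using labB notA by (auto simp: lab_def)
    then show ?thesis using B(2) \<open>p \<in> FQ\<close> by simp
  qed
qed

lemma label_image_combine:
  assumes "lab1 ` FA \<subseteq> Inl ` FP \<union> Inr ` I" "lab2 ` FB \<subseteq> Inl ` FQ \<union> Inr ` J"
  shows "(\<lambda>a. if a \<in> FA then lab1 a else lab2 a) ` (FA \<union> FB) \<subseteq>
    Inl ` (FP \<union> FQ) \<union> Inr ` (I \<union> J)"
  using assms by (auto simp: image_subset_iff image_iff)

lemma realizes_Field_nonempty: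
  "realizes P l u h A lab \<beta> \<Longrightarrow> Field P \<noteq> {} \<Longrightarrow> Field A \<noteq> {}"
  unfolding realizes_def by blast

text \<open>Both components use the full segment, since every maximal chain has to list all of its
  letters; this is where chain points come to label several points.\<close>

lemma realizes_poset_union:
  assumes P: "sp_poset P" and Q: "sp_poset Q" and disj: "Field P \<inter> Field Q = {}"
    and A: "realizes P l u h A lab1 \<beta>1" and B: "realizes Q l u h B lab2 \<beta>2"
    and disj': "Field A \<inter> Field B = {}"
  shows "realizes (poset_union P Q) l u h (poset_union A B)
    (\<lambda>a. if a \<in> Field A then lab1 a else lab2 a)
    (\<lambda>M. if M \<in> max_chains P then \<beta>1 M else \<beta>2 M)" (is "realizes _ _ _ _ _ ?lab ?\<beta>")
proof -
  note P' = sp_poset_partial_order[OF P] and Q' = sp_poset_partial_order[OF Q]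
  note A' = A[unfolded realizes_def] and B' = B[unfolded realizes_def]
  note ne = realizes_Field_nonempty[OF A P'(3)] realizes_Field_nonempty[OF B Q'(3)]
  have poA: "Partial_order A" "finite (Field A)" and poB: "Partial_order B" "finite (Field B)"
    using A' B' by auto
  have mcP: "max_chains (poset_union P Q) = max_chains P \<union> max_chains Q"
    by (rule max_chains_poset_union[OF P'(1,3) Q'(1,3) disj])
  have mcA: "max_chains (poset_union A B) = max_chains A \<union> max_chains B"
    by (rule max_chains_poset_union[OF poA(1) ne(1) poB(1) ne(2) disj'])
  \<comment> \<open>No nonempty list lies in both fields; this makes the case distinction in
    \<open>?\<beta>\<close> unambiguous.\<close>
  have dP: "max_chains P \<inter> max_chains Q = {}"
    using max_chains_subset_Field[OF P'(1)] max_chains_subset_Field[OF Q'(1)]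
      max_chains_nonempty[OF P'(1,3)] disj
    by (metis (no_types, lifting) disjoint_iff Int_subset_iff set_empty subset_empty)
  have dA: "max_chains A \<inter> max_chains B = {}"
    using max_chains_subset_Field[OF poA(1)] max_chains_subset_Field[OF poB(1)]
      max_chains_nonempty[OF poA(1) ne(1)] disj'
    by (metis (no_types, lifting) disjoint_iff Int_subset_iff set_empty subset_empty)
  have bij: "bij_betw ?\<beta> (max_chains P \<union> max_chains Q) (max_chains A \<union> max_chains B)"
    using A' B' dP dA by (intro bij_betw_if_Un) auto
  have words: "map ?lab (?\<beta> M) = chain_word l h M u"
    if M: "M \<in> max_chains P \<union> max_chains Q" for M
  proof (cases "M \<in> max_chains P")
    case True
    then have "set (\<beta>1 M) \<subseteq> Field A"
      using A' max_chains_subset_Field[OF poA(1)] by (metis bij_betwE)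
    then have "map ?lab (\<beta>1 M) = map lab1 (\<beta>1 M)"
      by auto
    then show ?thesis using True A' by simp
  next
    case False
    then have Q: "M \<in> max_chains Q" using M by blast
    then have "set (\<beta>2 M) \<subseteq> Field B"
      using B' max_chains_subset_Field[OF poB(1)] by (metis bij_betwE)
    then have "map ?lab (\<beta>2 M) = map lab2 (\<beta>2 M)"
      using disj' by auto
    then show ?thesis using False Q B' by simp
  qed
  have card: "card (S \<union> T) = card (S' \<union> T')"
    if "S \<subseteq> Field A" "T \<subseteq> Field B" "S' \<subseteq> Field P" "T' \<subseteq> Field Q"
      "card S = card S'" "card T = card T'" for S T S' T'
  proof -
    have "finite S" "finite T" "finite S'" "finite T'" "S \<inter> T = {}" "S' \<inter> T' = {}"
      using that poA(2) poB(2) P'(2) Q'(2) disj disj' by (blast intro: finite_subset)+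
    then show ?thesis
      using that by (simp add: card_Un_disjoint)
  qed
  show ?thesis
    unfolding realizes_def
  proof (intro conjI)
    show "Partial_order (poset_union A B)"
      using partial_order_poset_union poA(1) poB(1) disj' by blast
    show "finite (Field (poset_union A B))"
      using poA poB by simp
    show "?lab ` Field (poset_union A B) \<subseteq> Inl ` Field (poset_union P Q) \<union> Inr ` {Suc l..u}"
      using label_image_combine[of lab1 "Field A" "Field P" "{Suc l..u}" lab2 "Field B" "Field Q" "{Suc l..u}"]
        A' B' by simp
    show "\<forall>p\<in>Field (poset_union P Q). \<exists>!a. a \<in> Field (poset_union A B) \<and> ?lab a = Inl p"
      unfolding Field_poset_union
      using A' B' disj disj' by (intro Inl_label_combine[where I = "{Suc l..u}" and J = "{Suc l..u}"]) auto
    show "card (minimal_points (poset_union A B)) = card (minimal_points (poset_union P Q))"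
      unfolding minimal_points_poset_union[OF disj] minimal_points_poset_union[OF disj']
      using A' B' by (intro card extremal_points_subset) simp_all
    show "card (maximal_points (poset_union A B)) = card (maximal_points (poset_union P Q))"
      unfolding maximal_points_poset_union[OF disj] maximal_points_poset_union[OF disj']
      using A' B' by (intro card extremal_points_subset) simp_all
    show "bij_betw ?\<beta> (max_chains (poset_union P Q)) (max_chains (poset_union A B))"
      unfolding mcP mcA by (rule bij)
    show "\<forall>M\<in>max_chains (poset_union P Q). map ?lab (?\<beta> M) = chain_word l h M u"
      unfolding mcP using words by blast
  qed
qed

lemma append_eq_append_disjoint:
  assumes "xs @ ys = xs' @ ys'" "set xs \<subseteq> S" "set xs' \<subseteq> S" "set ys \<inter> S = {}" "set ys' \<inter> S = {}"
  shows "xs = xs' \<and> ys = ys'"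
proof -
  have *: "filter (\<lambda>x. x \<in> S) (xs @ ys) = xs" if "set xs \<subseteq> S" "set ys \<inter> S = {}" for xs ys
  proof -
    have "\<forall>x\<in>set xs. x \<in> S" "\<forall>x\<in>set ys. x \<notin> S"
      using that by blast+
    then show ?thesis by (simp add: filter_empty_conv filter_id_conv)
  qed
  show ?thesis
    using *[of xs ys] *[of xs' ys'] assms by simp
qed

text \<open>The lower summand receives the letters up to \<open>m\<close> and the upper one those
  from \<open>Suc m\<close> on. A maximal chain of the sum is taken apart by membership in
  \<open>Field P\<close>, and the images of its two parts are joined.\<close>

lemma realizes_ordinal_sum:
  assumes P: "sp_poset P" and Q: "sp_poset Q" and disj: "Field P \<inter> Field Q = {}"
    and A: "realizes P l m h A lab1 \<beta>1" and B: "realizes Q m u h B lab2 \<beta>2"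
    and iso: "isotone P l m h" "isotone Q m u h" and le: "l \<le> m" "m \<le> u"
    and disj': "Field A \<inter> Field B = {}"
  shows "realizes (ordinal_sum P Q) l u h (ordinal_sum A B)
    (\<lambda>a. if a \<in> Field A then lab1 a else lab2 a)
    (\<lambda>M. \<beta>1 (filter (\<lambda>x. x \<in> Field P) M) @ \<beta>2 (filter (\<lambda>x. x \<notin> Field P) M))"
    (is "realizes _ _ _ _ _ ?lab ?\<beta>")
proof -
  note P' = sp_poset_partial_order[OF P] and Q' = sp_poset_partial_order[OF Q]
  note A' = A[unfolded realizes_def] and B' = B[unfolded realizes_def]
  note ne = realizes_Field_nonempty[OF A P'(3)] realizes_Field_nonempty[OF B Q'(3)]
  have poA: "Partial_order A" "finite (Field A)" and poB: "Partial_order B" "finite (Field B)"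
    and bij1: "bij_betw \<beta>1 (max_chains P) (max_chains A)"
    and bij2: "bij_betw \<beta>2 (max_chains Q) (max_chains B)"
    using A' B' by auto
  note mcP = max_chains_ordinal_sum[OF P'(1) Q'(1) disj]
  note mcA = max_chains_ordinal_sum[OF poA(1) poB(1) disj']
  have \<beta>1: "\<beta>1 M \<in> max_chains A" "set (\<beta>1 M) \<subseteq> Field A" if "M \<in> max_chains P" for M
    using bij_betwE[OF bij1] max_chains_subset_Field[OF poA(1)] that by blast+
  have \<beta>2: "\<beta>2 M \<in> max_chains B" "set (\<beta>2 M) \<subseteq> Field B" if "M \<in> max_chains Q" for M
    using bij_betwE[OF bij2] max_chains_subset_Field[OF poB(1)] that by blast+
  have filter: "filter (\<lambda>x. x \<in> Field P) (M @ N) = M" "filter (\<lambda>x. x \<notin> Field P) (M @ N) = N"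
    if MN: "M \<in> max_chains P" "N \<in> max_chains Q" for M N
  proof -
    have "\<forall>x\<in>set M. x \<in> Field P" "\<forall>x\<in>set N. x \<notin> Field P"
      using MN max_chains_subset_Field[OF P'(1)] max_chains_subset_Field[OF Q'(1)] disj by blast+
    then show "filter (\<lambda>x. x \<in> Field P) (M @ N) = M" "filter (\<lambda>x. x \<notin> Field P) (M @ N) = N"
      by (simp_all add: filter_empty_conv filter_id_conv)
  qed
  have \<beta>: "?\<beta> (M @ N) = \<beta>1 M @ \<beta>2 N" if "M \<in> max_chains P" "N \<in> max_chains Q" for M N
    using filter[OF that] by simp
  have bij: "bij_betw ?\<beta> (max_chains (ordinal_sum P Q)) (max_chains (ordinal_sum A B))"
    unfolding bij_betw_def
  proof
    show "inj_on ?\<beta> (max_chains (ordinal_sum P Q))"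
    proof (rule inj_onI)
      fix K K' assume K: "K \<in> max_chains (ordinal_sum P Q)" "K' \<in> max_chains (ordinal_sum P Q)"
        and eq: "?\<beta> K = ?\<beta> K'"
      obtain M N where MN: "K = M @ N" "M \<in> max_chains P" "N \<in> max_chains Q"
        using K(1) unfolding mcP by blast
      obtain M' N' where MN': "K' = M' @ N'" "M' \<in> max_chains P" "N' \<in> max_chains Q"
        using K(2) unfolding mcP by blast
      have "\<beta>1 M @ \<beta>2 N = \<beta>1 M' @ \<beta>2 N'"
        using eq MN MN' \<beta> by metis
      then have "\<beta>1 M = \<beta>1 M' \<and> \<beta>2 N = \<beta>2 N'"
        using \<beta>1(2)[OF MN(2)] \<beta>1(2)[OF MN'(2)] \<beta>2(2)[OF MN(3)] \<beta>2(2)[OF MN'(3)] disj'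
        by (intro append_eq_append_disjoint[where S = "Field A"]) blast+
      then show "K = K'"
        using MN MN' bij1 bij2 by (auto simp: bij_betw_def dest: inj_onD)
    qed
    show "?\<beta> ` max_chains (ordinal_sum P Q) = max_chains (ordinal_sum A B)"
    proof (intro set_eqI iffI)
      fix C assume "C \<in> ?\<beta> ` max_chains (ordinal_sum P Q)"
      then obtain M N where MN: "C = ?\<beta> (M @ N)" "M \<in> max_chains P" "N \<in> max_chains Q"
        unfolding mcP by blast
      then show "C \<in> max_chains (ordinal_sum A B)"
        unfolding MN(1) \<beta>[OF MN(2,3)] mcA using \<beta>1(1)[OF MN(2)] \<beta>2(1)[OF MN(3)] by blast
    next
      fix C assume "C \<in> max_chains (ordinal_sum A B)"
      then obtain X Y where "C = X @ Y" "X \<in> max_chains A" "Y \<in> max_chains B"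
        unfolding mcA by blast
      then obtain M N where "C = \<beta>1 M @ \<beta>2 N" "M \<in> max_chains P" "N \<in> max_chains Q"
        using bij1 bij2 unfolding bij_betw_def by (metis imageE)
      then have "C = ?\<beta> (M @ N)" "M @ N \<in> max_chains (ordinal_sum P Q)"
        unfolding mcP using \<beta> by auto
      then show "C \<in> ?\<beta> ` max_chains (ordinal_sum P Q)"
        by (rule image_eqI)
    qed
  qed
  have words: "map ?lab (?\<beta> K) = chain_word l h K u" if K: "K \<in> max_chains (ordinal_sum P Q)" for K
  proof -
    obtain M N where MN: "K = M @ N" "M \<in> max_chains P" "N \<in> max_chains Q"
      using K unfolding mcP by blast
    have "map ?lab (\<beta>1 M) = map lab1 (\<beta>1 M)" "map ?lab (\<beta>2 N) = map lab2 (\<beta>2 N)"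
      using \<beta>1(2)[OF MN(2)] \<beta>2(2)[OF MN(3)] disj' by auto
    then have "map ?lab (?\<beta> K) = chain_word l h M m @ chain_word m h N u"
      using \<beta>[OF MN(2,3)] MN A' B' by (simp del: filter_append)
    also have "\<dots> = chain_word l h K u"
      unfolding MN(1) using MN iso le P'(1) Q'(1)
      by (intro chain_word_append isotone_sorted)
    finally show ?thesis .
  qed
  show ?thesis
    unfolding realizes_def
  proof (intro conjI)
    show "Partial_order (ordinal_sum A B)"
      using partial_order_ordinal_sum poA(1) poB(1) disj' by blast
    show "finite (Field (ordinal_sum A B))"
      using poA poB by simp
    have "{Suc l..m} \<union> {Suc m..u} = {Suc l..u}"
      using le by auto
    then show "?lab ` Field (ordinal_sum A B) \<subseteq> Inl ` Field (ordinal_sum P Q) \<union> Inr ` {Suc l..u}"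
      using label_image_combine[of lab1 "Field A" "Field P" "{Suc l..m}" lab2 "Field B" "Field Q" "{Suc m..u}"]
        A' B' by simp
    show "\<forall>p\<in>Field (ordinal_sum P Q). \<exists>!a. a \<in> Field (ordinal_sum A B) \<and> ?lab a = Inl p"
      unfolding Field_ordinal_sum
      using A' B' disj disj' by (intro Inl_label_combine[where I = "{Suc l..m}" and J = "{Suc m..u}"]) auto
    show "card (minimal_points (ordinal_sum A B)) = card (minimal_points (ordinal_sum P Q))"
      using minimal_points_ordinal_sum[OF disj P'(3)] minimal_points_ordinal_sum[OF disj' ne(1)] A'
      by simp
    show "card (maximal_points (ordinal_sum A B)) = card (maximal_points (ordinal_sum P Q))"
      using maximal_points_ordinal_sum[OF disj Q'(3)] maximal_points_ordinal_sum[OF disj' ne(2)] B'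
      by simp
    show "bij_betw ?\<beta> (max_chains (ordinal_sum P Q)) (max_chains (ordinal_sum A B))"
      by (rule bij)
    show "\<forall>M\<in>max_chains (ordinal_sum P Q). map ?lab (?\<beta> M) = chain_word l h M u"
      using words by blast
  qed
qed

lemma isotone_poset_union:
  "isotone (poset_union P Q) l u h \<longleftrightarrow> isotone P l u h \<and> isotone Q l u h"
  unfolding isotone_def Field_poset_union image_Un by (auto simp: in_poset_union)

text \<open>The maximum is attained at some \<open>p\<close>, and every point of \<open>Q\<close>
  lies above \<open>p\<close>; hence the lower bound on \<open>Q\<close>.\<close>

lemma isotone_ordinal_sum_split:
  assumes iso: "isotone (ordinal_sum P Q) l u h" and P: "finite (Field P)" "Field P \<noteq> {}"
  shows "isotone P l (Max (h ` Field P)) h" "isotone Q (Max (h ` Field P)) u h"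
    "l \<le> Max (h ` Field P)" "Max (h ` Field P) \<le> u"
proof -
  let ?m = "Max (h ` Field P)"
  have bounds: "l \<le> h p \<and> h p \<le> u" if "p \<in> Field P \<union> Field Q" for p
    using iso that unfolding isotone_def Field_ordinal_sum by fastforce
  have mono: "h p \<le> h q" if "(p, q) \<in> ordinal_sum P Q" for p q
    using iso that unfolding isotone_def by blast
  have fin: "finite (h ` Field P)" "h ` Field P \<noteq> {}"
    using P by auto
  then have le: "h p \<le> ?m" if "p \<in> Field P" for p
    using that by simp
  obtain p where p: "p \<in> Field P" "?m = h p"
    using Max_in[OF fin] by blast
  show "l \<le> ?m" "?m \<le> u"
    using bounds[of p] p by auto
  show "isotone P l ?m h"
    using bounds le mono by (auto simp: isotone_def in_ordinal_sum)
  show "isotone Q ?m u h"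
    using bounds p mono[of p] mono by (auto simp: isotone_def in_ordinal_sum)
qed

lemma isotone_realizable:
  assumes "sp_poset P"
  shows "isotone P l u h \<Longrightarrow> l \<le> u \<Longrightarrow> \<exists>A lab \<beta>. realizes P l u h A lab \<beta> \<and> Field A \<subseteq> {N..}"
  using assms
proof (induction arbitrary: l u N)
  case (sp_point a)
  then show ?case by (intro realizes_point)
next
  case (sp_union P Q)
  then have iso: "isotone P l u h" "isotone Q l u h"
    by (auto simp: isotone_poset_union)
  obtain A lab1 \<beta>1 where A: "realizes P l u h A lab1 \<beta>1" "Field A \<subseteq> {N..}"
    using sp_union.IH(1)[OF iso(1) sp_union.prems(2)] by blast
  \<comment> \<open>Beyond every point of \<open>A\<close>, which gives disjoint fields, and beyond
    \<open>N\<close>, so that the sum still lies in \<open>{N..}\<close>.\<close>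
  let ?N = "Suc (Max (Field A) + N)"
  obtain B lab2 \<beta>2 where B: "realizes Q l u h B lab2 \<beta>2" "Field B \<subseteq> {?N..}"
    using sp_union.IH(2)[OF iso(2) sp_union.prems(2), of ?N] by blast
  have "a < ?N" if "a \<in> Field A" for a
    using A(1) Max_ge[OF _ that] unfolding realizes_def by fastforce
  then have "Field A \<inter> Field B = {}"
    using B(2) by fastforce
  moreover have "Field (poset_union A B) \<subseteq> {N..}"
    using A(2) B(2) by fastforce
  ultimately show ?case
    using realizes_poset_union[OF sp_union(1-3) A(1) B(1)] by blast
next
  case (sp_osum P Q)
  note iso = isotone_ordinal_sum_split[OF sp_osum.prems(1) sp_poset_partial_order(2,3)[OF sp_osum(1)]]
  obtain A lab1 \<beta>1 where A: "realizes P l (Max (h ` Field P)) h A lab1 \<beta>1" "Field A \<subseteq> {N..}"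
    using sp_osum.IH(1)[OF iso(1,3)] by blast
  let ?N = "Suc (Max (Field A) + N)"
  obtain B lab2 \<beta>2 where B: "realizes Q (Max (h ` Field P)) u h B lab2 \<beta>2" "Field B \<subseteq> {?N..}"
    using sp_osum.IH(2)[OF iso(2,4), of ?N] by blast
  have "a < ?N" if "a \<in> Field A" for a
    using A(1) Max_ge[OF _ that] unfolding realizes_def by fastforce
  then have "Field A \<inter> Field B = {}"
    using B(2) by fastforce
  moreover have "Field (ordinal_sum A B) \<subseteq> {N..}"
    using A(2) B(2) by fastforce
  ultimately show ?case
    using realizes_ordinal_sum[OF sp_osum(1-3) A(1) B(1) iso] by blast
qed

text \<open>Extensionality fixes the values off \<open>Field P\<close>, so that an isotone map on
  \<open>P\<close> is counted only once.\<close>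

definition order_maps :: "'a rel \<Rightarrow> nat \<Rightarrow> nat \<Rightarrow> ('a \<Rightarrow> nat) set" where
  "order_maps P l u = {h \<in> extensional (Field P). isotone P l u h}"

lemma isotone_cong:
  assumes "\<And>p. p \<in> Field P \<Longrightarrow> h p = k p"
  shows "isotone P l u h \<longleftrightarrow> isotone P l u k"
proof -
  have "h ` Field P = k ` Field P"
    using assms by (intro image_cong) auto
  moreover have "h p = k p \<and> h q = k q" if "(p, q) \<in> P" for p q
    using that assms by (auto intro: FieldI1 FieldI2)
  ultimately show ?thesis
    unfolding isotone_def by fastforce
qed

lemma isotone_restrict [simp]: "isotone P l u (restrict h (Field P)) \<longleftrightarrow> isotone P l u h"
  by (rule isotone_cong) simp

section \<open>Equivalence classes of shuffles and isotone maps\<close>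

lemma realizes_is_shuffle:
  assumes "sp_poset P" "isotone P 0 n h" "realizes P 0 n h A lab \<beta>"
  shows "is_shuffle_via P n A lab \<beta>"
proof -
  have "map lab (\<beta> M) \<in> shuffles (map Inl M) (map Inr [1..<Suc n])" if M: "M \<in> max_chains P" for M
    using chain_word_in_shuffles[OF isotone_sorted[OF sp_poset_partial_order(1)[OF assms(1)] assms(2) le0 M]]
      M assms(3) by (simp add: realizes_def del: upt_Suc)
  then show ?thesis
    using assms(3) by (simp add: realizes_def is_shuffle_via_def del: upt_Suc)
qed

text \<open>Makes the height map an invariant of the labelled poset; both the description of the
  classes and the injectivity of the correspondence rest on it.\<close>

lemma shuffle_words_unique:
  assumes P: "sp_poset P" and sh: "is_shuffle_via P n A lab \<beta>" "is_shuffle_via P n A lab \<beta>'"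
    and iso: "isotone P 0 n h" "isotone P 0 n h'"
    and words: "\<And>M. M \<in> max_chains P \<Longrightarrow> map lab (\<beta> M) = chain_word 0 h M n"
      "\<And>M. M \<in> max_chains P \<Longrightarrow> map lab (\<beta>' M) = chain_word 0 h' M n"
    and p: "p \<in> Field P"
  shows "h p = h' p"
proof -
  note po = sp_poset_partial_order(1)[OF P]
  obtain M where M: "M \<in> max_chains P" "p \<in> set M"
    using sp_poset_max_chain_through[OF P partial_order_refl[OF po p]] by blast
  show ?thesis
    using shuffle_height_unique[OF sh M(1) M(1) M(2) M(2) p words(1)[OF M(1)]
        isotone_sorted[OF po iso(1) le0 M(1)] words(2)[OF M(1)] isotone_sorted[OF po iso(2) le0 M(1)]] .
qed

text \<open>Explicit form of the classes of \<open>shuffle_equiv\<close>; computing each class as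
  such a set replaces a separate study of the relation.\<close>

definition shuffles_of_height ::
  "'a rel \<Rightarrow> nat \<Rightarrow> ('a \<Rightarrow> nat) \<Rightarrow> (nat rel \<times> (nat \<Rightarrow> 'a + nat)) set" where
  "shuffles_of_height P n h = {(A, lab). \<exists>\<beta>. is_shuffle_via P n A lab \<beta> \<and>
     (\<forall>M\<in>max_chains P. map lab (\<beta> M) = chain_word 0 h M n)}"

lemma shuffle_class_eq:
  assumes P: "sp_poset P" and sh: "is_shuffle_via P n A lab \<beta>" and iso: "isotone P 0 n h"
    and words: "\<And>M. M \<in> max_chains P \<Longrightarrow> map lab (\<beta> M) = chain_word 0 h M n"
  shows "shuffle_equiv P n `` {(A, lab)} = shuffles_of_height P n h"
proof (intro equalityI subsetI)
  fix x assume x: "x \<in> shuffle_equiv P n `` {(A, lab)}"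
  obtain A' lab' where x': "x = (A', lab')" by fastforce
  obtain \<beta>1 \<beta>' where \<beta>: "is_shuffle_via P n A lab \<beta>1" "is_shuffle_via P n A' lab' \<beta>'"
      "\<And>M. M \<in> max_chains P \<Longrightarrow> map lab (\<beta>1 M) = map lab' (\<beta>' M)"
    using x unfolding x' shuffle_equiv_def by auto
  \<comment> \<open>\<open>\<beta>1\<close> comes from the relation and is not known to be
    \<open>\<beta>\<close>; its heights \<open>k\<close> agree with \<open>h\<close> on
    \<open>Field P\<close> because both are read off the same \<open>(A, lab)\<close>.\<close>
  obtain k where k: "isotone P 0 n k" "\<And>M. M \<in> max_chains P \<Longrightarrow> map lab (\<beta>1 M) = chain_word 0 k M n"
    using shuffle_isotone[OF P \<beta>(1)] by blast
  have "map lab' (\<beta>' M) = chain_word 0 h M n" if M: "M \<in> max_chains P" for M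
  proof -
    have "chain_word 0 k M n = chain_word 0 h M n"
      using max_chains_subset_Field[OF sp_poset_partial_order(1)[OF P] M]
        shuffle_words_unique[OF P \<beta>(1) sh k(1) iso k(2) words]
      by (intro chain_word_cong) blast
    then show ?thesis using \<beta>(3)[OF M] k(2)[OF M] by simp
  qed
  then show "x \<in> shuffles_of_height P n h"
    using \<beta>(2) unfolding x' shuffles_of_height_def by blast
next
  fix x assume "x \<in> shuffles_of_height P n h"
  then obtain A' lab' \<beta>' where x: "x = (A', lab')" "is_shuffle_via P n A' lab' \<beta>'"
      "\<And>M. M \<in> max_chains P \<Longrightarrow> map lab' (\<beta>' M) = chain_word 0 h M n"
    unfolding shuffles_of_height_def by auto
  then have "\<forall>M\<in>max_chains P. map lab (\<beta> M) = map lab' (\<beta>' M)"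
    using words by simp
  then show "x \<in> shuffle_equiv P n `` {(A, lab)}"
    using sh x(2) unfolding x(1) shuffle_equiv_def by blast
qed

text \<open>Isotone maps and classes correspond through \<open>shuffles_of_height\<close>.
  Realizability makes each of these sets nonempty, so if two of them are equal, a common element
  forces equal heights.\<close>

lemma card_hom_shuffle:
  assumes P: "sp_poset P"
  shows "card (hom_shuffle P n) = card (order_maps P 0 n)"
proof -
  let ?F = "shuffles_of_height P n"
  have ex: "\<exists>A lab \<beta>. is_shuffle_via P n A lab \<beta> \<and>
      (\<forall>M\<in>max_chains P. map lab (\<beta> M) = chain_word 0 h M n)" if h: "isotone P 0 n h" for h
  proof -
    obtain A lab \<beta> where r: "realizes P 0 n h A lab \<beta>"
      using isotone_realizable[OF P h le0] by blast
    then show ?thesis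
      using realizes_is_shuffle[OF P h r] by (auto simp: realizes_def)
  qed
  have "inj_on ?F (order_maps P 0 n)"
  proof (rule inj_onI)
    fix h h' assume h: "h \<in> order_maps P 0 n" "h' \<in> order_maps P 0 n" and eq: "?F h = ?F h'"
    obtain A lab \<beta> where A: "is_shuffle_via P n A lab \<beta>"
        "\<And>M. M \<in> max_chains P \<Longrightarrow> map lab (\<beta> M) = chain_word 0 h M n"
      using ex[of h] h by (auto simp: order_maps_def)
    then have "(A, lab) \<in> ?F h"
      unfolding shuffles_of_height_def by auto
    then have "(A, lab) \<in> ?F h'"
      using eq by simp
    then obtain \<beta>' where B: "is_shuffle_via P n A lab \<beta>'"
        "\<And>M. M \<in> max_chains P \<Longrightarrow> map lab (\<beta>' M) = chain_word 0 h' M n"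
      unfolding shuffles_of_height_def by auto
    have "h p = h' p" if "p \<in> Field P" for p
      using shuffle_words_unique[OF P A(1) B(1) _ _ A(2) B(2) that] h by (simp add: order_maps_def)
    then show "h = h'"
      using h by (auto simp: order_maps_def intro: extensionalityI)
  qed
  moreover have "?F ` order_maps P 0 n = hom_shuffle P n"
  proof (intro equalityI subsetI)
    fix c assume "c \<in> ?F ` order_maps P 0 n"
    then obtain h where h: "isotone P 0 n h" "c = ?F h"
      by (auto simp: order_maps_def)
    then obtain A lab \<beta> where A: "is_shuffle_via P n A lab \<beta>"
        "\<And>M. M \<in> max_chains P \<Longrightarrow> map lab (\<beta> M) = chain_word 0 h M n"
      using ex by blast
    have "(A, lab) \<in> poset_shuffles P n"
      using A by (auto simp: poset_shuffles_def)
    moreover have "shuffle_equiv P n `` {(A, lab)} = c"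
      unfolding h(2) by (rule shuffle_class_eq[OF P A(1) h(1) A(2)])
    ultimately show "c \<in> hom_shuffle P n"
      unfolding hom_shuffle_def using quotientI by metis
  next
    fix c assume "c \<in> hom_shuffle P n"
    then obtain A lab \<beta> where c: "c = shuffle_equiv P n `` {(A, lab)}"
      and A: "is_shuffle_via P n A lab \<beta>"
      unfolding hom_shuffle_def quotient_def poset_shuffles_def by auto
    obtain h where h: "isotone P 0 n h" "\<And>M. M \<in> max_chains P \<Longrightarrow> map lab (\<beta> M) = chain_word 0 h M n"
      using shuffle_isotone[OF P A] by blast
    \<comment> \<open>Heights off \<open>Field P\<close> are discarded to land in
      \<open>order_maps\<close>; the words do not see them.\<close>
    let ?h = "restrict h (Field P)"
    have iso: "isotone P 0 n ?h"
      using h(1) by simp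
    have words: "map lab (\<beta> M) = chain_word 0 ?h M n" if M: "M \<in> max_chains P" for M
      unfolding h(2)[OF M]
      using max_chains_subset_Field[OF sp_poset_partial_order(1)[OF P] M]
      by (intro chain_word_cong) auto
    have "c = ?F ?h"
      unfolding c by (rule shuffle_class_eq[OF P A iso words])
    moreover have "?h \<in> order_maps P 0 n"
      using iso by (simp add: order_maps_def)
    ultimately show "c \<in> ?F ` order_maps P 0 n"
      by blast
  qed
  ultimately show ?thesis
    by (metis card_image)
qed


section \<open>Counting isotone maps\<close>

lemma order_maps_bounds: "h \<in> order_maps P l u \<Longrightarrow> p \<in> Field P \<Longrightarrow> l \<le> h p \<and> h p \<le> u"
  unfolding order_maps_def isotone_def by fastforce

lemma finite_order_maps:
  assumes "finite (Field P)"
  shows "finite (order_maps P l u)"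
proof (rule finite_subset)
  show "order_maps P l u \<subseteq> Field P \<rightarrow>\<^sub>E {l..u}"
    by (auto simp: order_maps_def isotone_def PiE_def)
  show "finite (Field P \<rightarrow>\<^sub>E {l..u})"
    using assms by (simp add: finite_PiE)
qed

lemma card_order_maps_point: "card (order_maps {(a, a)} 0 n) = Suc n"
proof -
  have "order_maps {(a, a)} 0 n = {a} \<rightarrow>\<^sub>E {0..n}"
    by (auto simp: order_maps_def isotone_def PiE_def)
  then show ?thesis
    by (simp add: card_PiE)
qed

text \<open>Inverse of the pair of restrictions. Off both fields the second map answers, which is
  \<open>undefined\<close> there by extensionality, so the glued map is extensional on the
  union.\<close>

definition glue :: "'a set \<Rightarrow> ('a \<Rightarrow> nat) \<times> ('a \<Rightarrow> nat) \<Rightarrow> 'a \<Rightarrow> nat" where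
  "glue S fg = (\<lambda>x. if x \<in> S then fst fg x else snd fg x)"

lemma glue_restrict:
  "h \<in> extensional (S \<union> T) \<Longrightarrow> S \<inter> T = {} \<Longrightarrow> glue S (restrict h S, restrict h T) = h"
  by (auto simp: glue_def fun_eq_iff extensional_def)

lemma restrict_glue:
  assumes "f \<in> extensional S" "g \<in> extensional T" "S \<inter> T = {}"
  shows "restrict (glue S (f, g)) S = f" "restrict (glue S (f, g)) T = g"
    "glue S (f, g) \<in> extensional (S \<union> T)"
  using assms by (auto simp: glue_def fun_eq_iff extensional_def restrict_def)

lemma isotone_glue:
  assumes "Field P \<inter> Field Q = {}"
  shows "isotone P l u (glue (Field P) (f, g)) \<longleftrightarrow> isotone P l u f"
    "isotone Q l u (glue (Field P) (f, g)) \<longleftrightarrow> isotone Q l u g"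
  using assms by (auto simp: glue_def intro!: isotone_cong)

lemma card_order_maps_union:
  assumes disj: "Field P \<inter> Field Q = {}"
  shows "card (order_maps (poset_union P Q) l u) = card (order_maps P l u) * card (order_maps Q l u)"
proof -
  have "bij_betw (\<lambda>h. (restrict h (Field P), restrict h (Field Q)))
      (order_maps (poset_union P Q) l u) (order_maps P l u \<times> order_maps Q l u)"
  proof (rule bij_betw_byWitness[where f' = "glue (Field P)"])
    show "\<forall>h\<in>order_maps (poset_union P Q) l u.
        glue (Field P) (restrict h (Field P), restrict h (Field Q)) = h"
      using disj by (auto simp: order_maps_def glue_restrict)
    show "\<forall>fg\<in>order_maps P l u \<times> order_maps Q l u.
        (restrict (glue (Field P) fg) (Field P), restrict (glue (Field P) fg) (Field Q)) = fg"
      using disj restrict_glue by (auto simp: order_maps_def)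
    show "(\<lambda>h. (restrict h (Field P), restrict h (Field Q))) ` order_maps (poset_union P Q) l u
        \<subseteq> order_maps P l u \<times> order_maps Q l u"
      by (auto simp: order_maps_def isotone_poset_union)
    show "glue (Field P) ` (order_maps P l u \<times> order_maps Q l u) \<subseteq> order_maps (poset_union P Q) l u"
      using disj restrict_glue(3) by (auto simp: order_maps_def isotone_poset_union isotone_glue)
  qed
  then show ?thesis
    by (simp add: bij_betw_same_card card_cartesian_product)
qed

lemma card_order_maps_shift:
  assumes "m \<le> n"
  shows "card (order_maps Q m n) = card (order_maps Q 0 (n - m))"
proof (rule bij_betw_same_card)
  show "bij_betw (\<lambda>h. \<lambda>x\<in>Field Q. h x - m) (order_maps Q m n) (order_maps Q 0 (n - m))"
  proof (rule bij_betw_byWitness[where f' = "\<lambda>h. \<lambda>x\<in>Field Q. h x + m"])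
    \<comment> \<open>All values are at least \<open>m\<close>, so the subtraction is not truncated
      and can be undone.\<close>
    show "\<forall>h\<in>order_maps Q m n. (\<lambda>x\<in>Field Q. (\<lambda>x\<in>Field Q. h x - m) x + m) = h"
      using order_maps_bounds[of _ Q m n]
      by (auto simp: order_maps_def fun_eq_iff extensional_def restrict_def)
    show "\<forall>h\<in>order_maps Q 0 (n - m). (\<lambda>x\<in>Field Q. (\<lambda>x\<in>Field Q. h x + m) x - m) = h"
      by (auto simp: order_maps_def fun_eq_iff extensional_def restrict_def)
    show "(\<lambda>h. \<lambda>x\<in>Field Q. h x - m) ` order_maps Q m n \<subseteq> order_maps Q 0 (n - m)"
    proof (rule image_subsetI)
      fix h assume h: "h \<in> order_maps Q m n"
      have "isotone Q 0 (n - m) (\<lambda>x. h x - m)"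
        using h by (auto simp: order_maps_def isotone_def image_subset_iff intro!: diff_le_mono)
      then show "(\<lambda>x\<in>Field Q. h x - m) \<in> order_maps Q 0 (n - m)"
        by (simp add: order_maps_def)
    qed
    show "(\<lambda>h. \<lambda>x\<in>Field Q. h x + m) ` order_maps Q 0 (n - m) \<subseteq> order_maps Q m n"
    proof (rule image_subsetI)
      fix h assume h: "h \<in> order_maps Q 0 (n - m)"
      have "h x + m \<le> n" if "x \<in> Field Q" for x
        using order_maps_bounds[OF h that] assms by linarith
      then have "isotone Q m n (\<lambda>x. h x + m)"
        using h by (auto simp: order_maps_def isotone_def)
      then show "(\<lambda>x\<in>Field Q. h x + m) \<in> order_maps Q m n"
        by (simp add: order_maps_def)
    qed
  qed
qed

definition order_maps_attaining :: "'a rel \<Rightarrow> nat \<Rightarrow> ('a \<Rightarrow> nat) set" where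
  "order_maps_attaining P m = {f \<in> order_maps P 0 m. m \<in> f ` Field P}"

text \<open>These are the coefficients of f (1 - x), for f the series counting isotone maps: a map
  bounded by \<open>Suc m\<close> either attains this value or is bounded by
  \<open>m\<close>.\<close>

lemma card_order_maps_attaining:
  assumes "finite (Field P)" "Field P \<noteq> {}"
  shows "card (order_maps_attaining P 0) = card (order_maps P 0 0)"
    "card (order_maps P 0 (Suc m)) = card (order_maps_attaining P (Suc m)) + card (order_maps P 0 m)"
proof -
  \<comment> \<open>A map on a nonempty \<open>P\<close> has to take the only available value
    0.\<close>
  have "0 \<in> f ` Field P" if "f \<in> order_maps P 0 0" for f
    using order_maps_bounds[OF that] assms(2) by force
  then have "order_maps_attaining P 0 = order_maps P 0 0"
    by (auto simp: order_maps_attaining_def)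
  then show "card (order_maps_attaining P 0) = card (order_maps P 0 0)"
    by simp
  have "f \<in> order_maps P 0 m" if f: "f \<in> order_maps P 0 (Suc m)" "Suc m \<notin> f ` Field P" for f
  proof -
    have "f p \<le> m" if "p \<in> Field P" for p
      using order_maps_bounds[OF f(1) that] f(2) that by (metis image_eqI le_SucE)
    then show ?thesis
      using f(1) by (auto simp: order_maps_def isotone_def)
  qed
  moreover have "order_maps P 0 m \<subseteq> order_maps P 0 (Suc m)"
    by (auto simp: order_maps_def isotone_def)
  ultimately have "order_maps P 0 (Suc m) = order_maps_attaining P (Suc m) \<union> order_maps P 0 m"
    by (auto simp: order_maps_attaining_def)
  moreover have "order_maps_attaining P (Suc m) \<inter> order_maps P 0 m = {}"
    using order_maps_bounds[of _ P 0 m] by (fastforce simp: order_maps_attaining_def)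
  moreover have "finite (order_maps_attaining P (Suc m))" "finite (order_maps P 0 m)"
    using finite_order_maps[OF assms(1)] by (auto simp: order_maps_attaining_def)
  ultimately show "card (order_maps P 0 (Suc m)) =
      card (order_maps_attaining P (Suc m)) + card (order_maps P 0 m)"
    by (simp add: card_Un_disjoint)
qed

text \<open>An isotone map corresponds to a triple of the cut \<open>m\<close>, a lower map
  attaining \<open>m\<close> and an upper map with values in \<open>{m..n}\<close>. If
  \<open>m\<close> did not have to be attained, one map would arise from every admissible
  cut.\<close>

lemma card_order_maps_osum:
  assumes P: "finite (Field P)" "Field P \<noteq> {}" and Q: "finite (Field Q)"
    and disj: "Field P \<inter> Field Q = {}"
  shows "card (order_maps (ordinal_sum P Q) 0 n) =
    (\<Sum>m=0..n. card (order_maps_attaining P m) * card (order_maps Q 0 (n - m)))"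
proof -
  let ?S = "SIGMA m:{0..n}. order_maps_attaining P m \<times> order_maps Q m n"
  let ?max = "\<lambda>h :: 'a \<Rightarrow> nat. Max (h ` Field P)"
  have maxI: "?max f = m" if "f \<in> order_maps_attaining P m" for f m
    using that P order_maps_bounds[of f P 0 m] by (intro Max_eqI) (auto simp: order_maps_attaining_def)
  have isoI: "isotone (ordinal_sum P Q) 0 n h"
    if "isotone P 0 m h" "isotone Q m n h" "m \<le> n" for h m
  proof -
    have "h p \<le> m" if "p \<in> Field P" for p
      using \<open>isotone P 0 m h\<close> that unfolding isotone_def by fastforce
    moreover have "m \<le> h q \<and> h q \<le> n" if "q \<in> Field Q" for q
      using \<open>isotone Q m n h\<close> that unfolding isotone_def by fastforce
    moreover have "h p \<le> h q" if "(p, q) \<in> P \<or> (p, q) \<in> Q" for p q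
      using \<open>isotone P 0 m h\<close> \<open>isotone Q m n h\<close> that unfolding isotone_def by blast
    ultimately show ?thesis
      using \<open>m \<le> n\<close> unfolding isotone_def Field_ordinal_sum
      by (auto simp: in_ordinal_sum) (meson le_trans)+
  qed
  have "bij_betw (\<lambda>h. (?max h, restrict h (Field P), restrict h (Field Q)))
      (order_maps (ordinal_sum P Q) 0 n) ?S"
  proof (rule bij_betw_byWitness[where f' = "\<lambda>x. glue (Field P) (snd x)"])
    show "\<forall>h\<in>order_maps (ordinal_sum P Q) 0 n.
        glue (Field P) (snd (?max h, restrict h (Field P), restrict h (Field Q))) = h"
      using disj by (auto simp: order_maps_def glue_restrict)
    show "\<forall>x\<in>?S. (?max (glue (Field P) (snd x)), restrict (glue (Field P) (snd x)) (Field P),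
        restrict (glue (Field P) (snd x)) (Field Q)) = x"
    proof
      fix x assume x: "x \<in> ?S"
      obtain m f g where mfg: "x = (m, f, g)" by (cases x)
      have "glue (Field P) (f, g) ` Field P = f ` Field P"
        by (auto simp: glue_def)
      then show "(?max (glue (Field P) (snd x)), restrict (glue (Field P) (snd x)) (Field P),
          restrict (glue (Field P) (snd x)) (Field Q)) = x"
        using x disj maxI restrict_glue[of f "Field P" g "Field Q"]
        by (auto simp: mfg order_maps_def order_maps_attaining_def)
    qed
    show "(\<lambda>h. (?max h, restrict h (Field P), restrict h (Field Q))) `
        order_maps (ordinal_sum P Q) 0 n \<subseteq> ?S"
    proof (rule image_subsetI)
      fix h assume "h \<in> order_maps (ordinal_sum P Q) 0 n"
      then have h: "isotone (ordinal_sum P Q) 0 n h"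
        by (simp add: order_maps_def)
      have "?max h \<in> h ` Field P"
        using P by (intro Max_in) auto
      then show "(?max h, restrict h (Field P), restrict h (Field Q)) \<in> ?S"
        using isotone_ordinal_sum_split[OF h P] by (auto simp: order_maps_def order_maps_attaining_def)
    qed
    show "(\<lambda>x. glue (Field P) (snd x)) ` ?S \<subseteq> order_maps (ordinal_sum P Q) 0 n"
    proof (rule image_subsetI)
      fix x assume x: "x \<in> ?S"
      obtain m f g where mfg: "x = (m, f, g)" by (cases x)
      have fg: "f \<in> extensional (Field P)" "g \<in> extensional (Field Q)" "isotone P 0 m f"
          "isotone Q m n g" "m \<le> n"
        using x by (auto simp: mfg order_maps_def order_maps_attaining_def)
      have "isotone (ordinal_sum P Q) 0 n (glue (Field P) (f, g))"
        using fg by (intro isoI[of m]) (simp_all add: isotone_glue[OF disj])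
      then show "glue (Field P) (snd x) \<in> order_maps (ordinal_sum P Q) 0 n"
        using restrict_glue(3)[OF fg(1,2) disj] by (simp add: mfg order_maps_def)
    qed
  qed
  then have "card (order_maps (ordinal_sum P Q) 0 n) = card ?S"
    by (rule bij_betw_same_card)
  also have "\<dots> = (\<Sum>m=0..n. card (order_maps_attaining P m \<times> order_maps Q m n))"
    using finite_order_maps[OF P(1)] finite_order_maps[OF Q]
    by (intro card_SigmaI) (auto simp: order_maps_attaining_def)
  \<comment> \<open>Shifting the upper maps down by \<open>m\<close> turns the sum into a
    convolution.\<close>
  also have "\<dots> = (\<Sum>m=0..n. card (order_maps_attaining P m) * card (order_maps Q 0 (n - m)))"
    using card_order_maps_shift[of _ n Q]
    by (intro sum.cong) (simp_all add: card_cartesian_product)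
  finally show ?thesis .
qed


section \<open>Shuffle series\<close>

lemma shuffle_series_nth:
  "sp_poset P \<Longrightarrow> fps_nth (shuffle_series P) n = of_nat (card (order_maps P 0 n))"
  by (simp add: shuffle_series_def card_hom_shuffle)

text \<open>The coefficients are 1, 2, 3, ...; one factor 1 - x turns them into the constant
  sequence 1, a second one into the series 1.\<close>

lemma shuffle_series_point: "shuffle_series {(a, a)} = 1 / (1 - fps_X)\<^sup>2"
proof -
  have "shuffle_series {(a, a)} * (1 - fps_X) = Abs_fps (\<lambda>_. 1)"
    by (intro fps_ext) (auto simp: shuffle_series_nth sp_point card_order_maps_point
        right_diff_distrib of_nat_diff)
  moreover have "Abs_fps (\<lambda>_. 1) * (1 - fps_X) = (1 :: rat fps)"
    by (intro fps_ext) (auto simp: right_diff_distrib)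
  ultimately have eq: "shuffle_series {(a, a)} * (1 - fps_X)\<^sup>2 = 1"
    by (simp add: power2_eq_square flip: mult.assoc)
  \<comment> \<open>The division cancels against a nonzero series; the constant coefficient shows
    that it is one.\<close>
  have "fps_nth ((1 - fps_X)\<^sup>2 :: rat fps) 0 \<noteq> 0"
    by simp
  then have "((1 - fps_X)\<^sup>2 :: rat fps) \<noteq> 0"
    by (metis fps_zero_nth)
  then show ?thesis
    using nonzero_mult_div_cancel_right[of "(1 - fps_X)\<^sup>2" "shuffle_series {(a, a)}"] eq by simp
qed

lemma shuffle_series_union:
  assumes "sp_poset P" "sp_poset Q" "Field P \<inter> Field Q = {}"
  shows "shuffle_series (poset_union P Q) = gamma_union (shuffle_series P) (shuffle_series Q)"
  using assms
  by (intro fps_ext) (simp add: gamma_union_def shuffle_series_nth sp_union card_order_maps_union)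

lemma shuffle_series_osum:
  assumes P: "sp_poset P" and Q: "sp_poset Q" and disj: "Field P \<inter> Field Q = {}"
  shows "shuffle_series (ordinal_sum P Q) = gamma_osum (shuffle_series P) (shuffle_series Q)"
proof (rule fps_ext)
  fix n
  note P' = sp_poset_partial_order(2,3)[OF P]
  have *: "fps_nth (shuffle_series P * (1 - fps_X)) m = of_nat (card (order_maps_attaining P m))" for m
    using card_order_maps_attaining[OF P']
    by (cases m) (simp_all add: right_diff_distrib shuffle_series_nth[OF P])
  show "fps_nth (shuffle_series (ordinal_sum P Q)) n =
      fps_nth (gamma_osum (shuffle_series P) (shuffle_series Q)) n"
    \<comment> \<open>The pattern for the left factor restricts the expansion to the outer product,
      so that \<open>*\<close> rewrites the inner one as a whole.\<close>
    unfolding gamma_osum_def fps_mult_nth[of "_ * _"] * shuffle_series_nth[OF Q]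
      shuffle_series_nth[OF sp_osum[OF P Q disj]]
      card_order_maps_osum[OF P' sp_poset_partial_order(2)[OF Q] disj]
    by simp
qed

section \<open>Factorizations and the generated algebra\<close>

lemma chain_poset_1: "chain_poset 1 = {(1, 1)}"
  by (auto simp: chain_poset_def)

text \<open>The induction carries \<open>sp_poset\<close> along, since the rules for the series of
  the two sums assume it.\<close>

lemma tree_evaluates_to_series:
  assumes "tree_evaluates_to t P"
  shows "sp_poset P \<and> tree_series (1 / (1 - fps_X)\<^sup>2) t = shuffle_series P"
  using assms
  by induction (auto intro: sp_poset.intros
      simp: shuffle_series_point shuffle_series_union shuffle_series_osum)

text \<open>Closure under the operations needs disjoint copies of posets, for which a finite point
  type has no room; hence natural numbers as points. The free bound \<open>N\<close> places the
  poset for \<open>h\<close> beyond the one for \<open>g\<close>.\<close>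

lemma sp_generated_realizable:
  fixes N :: nat
  assumes "g \<in> sp_generated (1 / (1 - fps_X)\<^sup>2)"
  shows "\<exists>P :: nat rel. sp_poset P \<and> Field P \<subseteq> {N..} \<and> g = shuffle_series P"
  using assms
proof (induction arbitrary: N)
  case gen_base
  have "sp_poset {(N, N)}" "Field {(N, N)} \<subseteq> {N..}"
    by (auto intro: sp_point)
  then show ?case
    using shuffle_series_point[of N, symmetric] by blast
next
  case (gen_union g h)
  obtain P :: "nat rel" where P: "sp_poset P" "Field P \<subseteq> {N..}" "g = shuffle_series P"
    using gen_union.IH(1) by blast
  obtain Q :: "nat rel" where Q: "sp_poset Q" "Field Q \<subseteq> {Suc (Max (Field P) + N)..}" "h = shuffle_series Q"
    using gen_union.IH(2) by blast
  have "a \<notin> Field Q" if "a \<in> Field P" for a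
    using Q(2) Max_ge[OF sp_poset_partial_order(2)[OF P(1)] that] by fastforce
  then have disj: "Field P \<inter> Field Q = {}"
    by blast
  have "Field (poset_union P Q) \<subseteq> {N..}"
    using P(2) Q(2) by fastforce
  then show ?case
    unfolding P(3) Q(3)
    using sp_union[OF P(1) Q(1) disj] shuffle_series_union[OF P(1) Q(1) disj, symmetric] by blast
next
  case (gen_osum g h)
  obtain P :: "nat rel" where P: "sp_poset P" "Field P \<subseteq> {N..}" "g = shuffle_series P"
    using gen_osum.IH(1) by blast
  obtain Q :: "nat rel" where Q: "sp_poset Q" "Field Q \<subseteq> {Suc (Max (Field P) + N)..}" "h = shuffle_series Q"
    using gen_osum.IH(2) by blast
  have "a \<notin> Field Q" if "a \<in> Field P" for a
    using Q(2) Max_ge[OF sp_poset_partial_order(2)[OF P(1)] that] by fastforce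
  then have disj: "Field P \<inter> Field Q = {}"
    by blast
  have "Field (ordinal_sum P Q) \<subseteq> {N..}"
    using P(2) Q(2) by fastforce
  then show ?case
    unfolding P(3) Q(3)
    using sp_osum[OF P(1) Q(1) disj] shuffle_series_osum[OF P(1) Q(1) disj, symmetric] by blast
qed

lemma sp_poset_series_generated:
  "sp_poset P \<Longrightarrow> shuffle_series P \<in> sp_generated (1 / (1 - fps_X)\<^sup>2)"
  by (induction rule: sp_poset.induct)
    (auto intro: sp_generated.intros simp: shuffle_series_point shuffle_series_union shuffle_series_osum)

theorem theorem2p23:
  shows "shuffle_series (chain_poset 1) = 1 / (1 - fps_X)\<^sup>2 \<and>
    sp_generated (shuffle_series (chain_poset 1)) =
      {shuffle_series P | P :: nat rel. sp_poset P} \<and>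
    (\<forall>(P :: 'a rel) t. sp_poset P \<and> factorization t P \<longrightarrow>
      tree_series (1 / (1 - fps_X)\<^sup>2) t = shuffle_series P)"
proof (intro conjI allI impI)
  show base: "shuffle_series (chain_poset 1) = 1 / (1 - fps_X)\<^sup>2"
    unfolding chain_poset_1 by (rule shuffle_series_point)
  show "sp_generated (shuffle_series (chain_poset 1)) = {shuffle_series P | P :: nat rel. sp_poset P}"
    unfolding base using sp_generated_realizable sp_poset_series_generated by blast
next
  fix P :: "'a rel" and t
  assume "sp_poset P \<and> factorization t P"
  then show "tree_series (1 / (1 - fps_X)\<^sup>2) t = shuffle_series P"
    using tree_evaluates_to_series by (auto simp: factorization_def)
qed

end
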